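(* Let $n \ge 1$, let $\lambda$ be a partition of $n$ and let $\ell > 1$ be an odd natural number. Each of the following conditions implies that $\lambda = \lambda'$, where $\lambda'$ is the conjugate partition of $\lambda$: (i) $\chi^\lambda$ vanishes on all cycles of even length in $S_n$; (ii) $\chi^\lambda$ vanishes on every element of the set $$Z_\ell(n) = \{ (1\,2\,\ldots\,2j) : 1 \le j \le n/2,\ \ell \nmid j \} \cup \{ (1\,2\,\ldots\,2k\ell-1)(2k\ell\ \ 2k\ell+1) : 1 < 2k\ell < n \} \subseteq S_n,$$ where $j$ and $k$ range over natural numbers; (iii) $\chi^\lambda$ vanishes on every odd $\ell'$-element of $S_n$, that is, on every odd permutation in $S_n$ whose order is not divisible by $\ell$.
   Context: For a partition $\lambda$ of $n$, $\chi^\lambda$ denotes the ordinary irreducible character of the symmetric group $S_n$ afforded by the Specht module $S^\lambda$ over a field of characteristic zero. The conjugate $\lambda'$ is the partition whose Young diagram is the transpose of that of $\lambda$. Natural numbers are positive integers. *)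

theory Defs
  imports Complex_Main "HOL-Library.Function_Algebras" "HOL-Algebra.Sym_Groups"
    "HOL-Algebra.Multiplicative_Group"
begin

section \<open>The trace of an endomorphism of a finite-dimensional function space\<close>

definition fscale :: "'k::field \<Rightarrow> ('x \<Rightarrow> 'k) \<Rightarrow> 'x \<Rightarrow> 'k" where
  "fscale c v = (\<lambda>x. c * v x)"

global_interpretation fun_vs: vector_space "fscale :: 'k::field \<Rightarrow> ('x \<Rightarrow> 'k) \<Rightarrow> 'x \<Rightarrow> 'k"
  by standard (auto simp: fscale_def fun_eq_iff algebra_simps)

text \<open>
  The choice of the basis does not matter by \<open>trace_on_eq\<close> below. The definition is only
  meaningful if \<open>V\<close> is a finite-dimensional subspace on which \<open>f\<close> acts linearly.
\<close>

definition trace_on :: "('x \<Rightarrow> 'k::field) set \<Rightarrow> (('x \<Rightarrow> 'k) \<Rightarrow> ('x \<Rightarrow> 'k)) \<Rightarrow> 'k" where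
  "trace_on V f =
     (let B = (SOME B. finite B \<and> fun_vs.independent B \<and> fun_vs.span B = V)
      in \<Sum>b\<in>B. fun_vs.representation B (f b) b)"

lemma trace_basis_change:
  assumes f: "Vector_Spaces.linear fscale fscale f"
    and B: "finite B" "fun_vs.independent B" "fun_vs.span B = V"
    and C: "finite C" "fun_vs.independent C" "fun_vs.span C = V"
    and inv: "f ` V \<subseteq> V"
  shows "(\<Sum>b\<in>B. fun_vs.representation B (f b) b) = (\<Sum>c\<in>C. fun_vs.representation C (f c) c)"
proof -
  interpret f: Vector_Spaces.linear fscale fscale f by (rule f)
  have BV: "b \<in> V" if "b \<in> B" for b using that B(3) fun_vs.span_base by blast
  have CV: "c \<in> V" if "c \<in> C" for c using that C(3) fun_vs.span_base by blast
  have fV: "f v \<in> V" if "v \<in> V" for v using that inv by blast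
  have expB: "(\<Sum>b\<in>B. fscale (fun_vs.representation B v b) b) = v" if "v \<in> V" for v
    using fun_vs.sum_representation_eq[OF B(2) _ B(1) order_refl] that B(3) by simp
  have expC: "(\<Sum>c\<in>C. fscale (fun_vs.representation C v c) c) = v" if "v \<in> V" for v
    using fun_vs.sum_representation_eq[OF C(2) _ C(1) order_refl] that C(3) by simp
  have 1: "fun_vs.representation B (f b) b = (\<Sum>c\<in>C. fun_vs.representation C b c * fun_vs.representation B (f c) b)"
    if "b \<in> B" for b
  proof -
    have "f b = (\<Sum>c\<in>C. fscale (fun_vs.representation C b c) (f c))"
      using arg_cong[OF expC[OF BV[OF that]], of f] by (simp add: f.sum f.scale)
    hence "fun_vs.representation B (f b) b = fun_vs.representation B (\<Sum>c\<in>C. fscale (fun_vs.representation C b c) (f c)) b"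
      by simp
    also have "\<dots> = (\<Sum>c\<in>C. fun_vs.representation B (fscale (fun_vs.representation C b c) (f c)) b)"
      by (subst fun_vs.representation_sum[OF B(2)]) (auto simp: B(3) CV fV intro!: fun_vs.span_scale[of _ B, unfolded B(3)])
    also have "\<dots> = (\<Sum>c\<in>C. fun_vs.representation C b c * fun_vs.representation B (f c) b)"
      by (intro sum.cong refl) (simp add: fun_vs.representation_scale[OF B(2)] B(3) CV fV)
    finally show ?thesis .
  qed
  have 2: "fun_vs.representation C (f c) c = (\<Sum>b\<in>B. fun_vs.representation C b c * fun_vs.representation B (f c) b)"
    if "c \<in> C" for c
  proof -
    have "fun_vs.representation C (f c) c = fun_vs.representation C (\<Sum>b\<in>B. fscale (fun_vs.representation B (f c) b) b) c"
      using expB[OF fV[OF CV[OF that]]] by simp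
    also have "\<dots> = (\<Sum>b\<in>B. fun_vs.representation C (fscale (fun_vs.representation B (f c) b) b) c)"
      by (subst fun_vs.representation_sum[OF C(2)]) (auto simp: C(3) BV intro!: fun_vs.span_scale[of _ C, unfolded C(3)])
    also have "\<dots> = (\<Sum>b\<in>B. fun_vs.representation C b c * fun_vs.representation B (f c) b)"
      by (intro sum.cong refl) (simp add: fun_vs.representation_scale[OF C(2)] C(3) BV mult.commute)
    finally show ?thesis .
  qed
  show ?thesis
    by (simp add: 1 2 sum.swap[of _ C B])
qed

lemma trace_on_eq:
  assumes "Vector_Spaces.linear fscale fscale f"
    and B: "finite B" "fun_vs.independent B" "fun_vs.span B = V"
    and "f ` V \<subseteq> V"
  shows "trace_on V f = (\<Sum>b\<in>B. fun_vs.representation B (f b) b)"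
proof -
  let ?P = "\<lambda>B. finite B \<and> fun_vs.independent B \<and> fun_vs.span B = V"
  have "?P (SOME B. ?P B)" using B by (intro someI[of ?P B]) auto
  then show ?thesis
    unfolding trace_on_def Let_def using trace_basis_change assms by blast
qed


section \<open>Partitions and Young diagrams\<close>

definition partition_of :: "nat \<Rightarrow> nat list \<Rightarrow> bool" where
  "partition_of n lam \<longleftrightarrow> sorted_wrt (\<ge>) lam \<and> 0 \<notin> set lam \<and> sum_list lam = n"

text \<open>Boxes are pairs (row, column), both counted from \<open>0\<close>.\<close>

definition young_diagram :: "nat list \<Rightarrow> (nat \<times> nat) set" where
  "young_diagram lam = {(i, j). i < length lam \<and> j < lam ! i}"

definition conjugate :: "nat list \<Rightarrow> nat list" where
  "conjugate lam =
     map (\<lambda>j. length (filter (\<lambda>r. j < r) lam)) [0..<(if lam = [] then 0 else hd lam)]"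

lemma filter_less_sorted:
  assumes "sorted_wrt (\<ge>) (lam :: nat list)"
  shows "i < length (filter (\<lambda>r. j < r) lam) \<longleftrightarrow> i < length lam \<and> j < lam ! i"
  using assms
proof (induction lam arbitrary: i)
  case (Cons a lam)
  show ?case
  proof (cases "j < a")
    case True
    then show ?thesis using Cons by (cases i) auto
  next
    case False
    then have none: "\<forall>r\<in>set (a # lam). \<not> j < r" using Cons.prems by auto
    then have "filter (\<lambda>r. j < r) (a # lam) = []" by (simp only: filter_empty_conv)
    moreover have "\<not> j < (a # lam) ! i" if "i < length (a # lam)"
      using none nth_mem[OF that] by blast
    ultimately show ?thesis by fastforce
  qed
qed simp

lemma young_diagram_conjugate:
  assumes "partition_of n lam"
  shows "young_diagram (conjugate lam) = prod.swap ` young_diagram lam"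
proof -
  have s: "sorted_wrt (\<ge>) lam" using assms by (simp add: partition_of_def)
  have hd: "lam ! i \<le> hd lam" if "i < length lam" for i
    using s that by (cases lam; cases i) auto
  have "(j, i) \<in> young_diagram (conjugate lam) \<longleftrightarrow> (i, j) \<in> young_diagram lam" for i j
    using hd[of i] filter_less_sorted[OF s, of i j]
    by (auto simp: young_diagram_def conjugate_def)
  then show ?thesis by force
qed


section \<open>Tableaux and tabloids\<close>

text \<open>
  A tableau of shape \<open>lam\<close> fills the boxes bijectively with \<open>1, \<dots>, n\<close> where
  \<open>n = sum_list lam\<close>. Positions outside the diagram carry the value \<open>0\<close>, which every
  permutation of \<open>{1..n}\<close> fixes, so that \<open>\<sigma> \<circ> t\<close> is again a tableau.
\<close>

definition tableaux :: "nat list \<Rightarrow> (nat \<times> nat \<Rightarrow> nat) set" where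
  "tableaux lam =
     {t. bij_betw t (young_diagram lam) {1..sum_list lam} \<and> (\<forall>c. c \<notin> young_diagram lam \<longrightarrow> t c = 0)}"

definition row_entries :: "nat list \<Rightarrow> (nat \<times> nat \<Rightarrow> nat) \<Rightarrow> nat \<Rightarrow> nat set" where
  "row_entries lam t i = t ` {c \<in> young_diagram lam. fst c = i}"

definition col_entries :: "nat list \<Rightarrow> (nat \<times> nat \<Rightarrow> nat) \<Rightarrow> nat \<Rightarrow> nat set" where
  "col_entries lam t j = t ` {c \<in> young_diagram lam. snd c = j}"

type_synonym tabloid = "(nat \<times> nat \<Rightarrow> nat) set"

definition tabloid_of :: "nat list \<Rightarrow> (nat \<times> nat \<Rightarrow> nat) \<Rightarrow> tabloid" where
  "tabloid_of lam t = {s \<in> tableaux lam. \<forall>i. row_entries lam s i = row_entries lam t i}"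

definition column_stabilizer :: "nat list \<Rightarrow> (nat \<times> nat \<Rightarrow> nat) \<Rightarrow> (nat \<Rightarrow> nat) set" where
  "column_stabilizer lam t =
     {p \<in> carrier (sym_group (sum_list lam)). \<forall>j. p ` col_entries lam t j = col_entries lam t j}"


section \<open>Specht modules and their characters\<close>

text \<open>
  The permutation module on the tabloids of shape \<open>lam\<close> is realised inside the space of
  all functions \<open>tabloid \<Rightarrow> 'k\<close>; the basis vector belonging to a tabloid is its indicator function.
\<close>

definition tabloid_vec :: "nat list \<Rightarrow> (nat \<times> nat \<Rightarrow> nat) \<Rightarrow> tabloid \<Rightarrow> 'k::field" where
  "tabloid_vec lam t = (\<lambda>T. if T = tabloid_of lam t then 1 else 0)"

text \<open>
  The linear extension of \<open>{t} \<mapsto> {\<sigma> \<circ> t}\<close>: the coefficient of \<open>\<sigma> v\<close> at \<open>T\<close> is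
  that of \<open>v\<close> at the image of \<open>T\<close> under the inverse of \<open>\<sigma>\<close>, see \<open>perm_act_tabloid_vec\<close>.
\<close>

definition perm_act :: "(nat \<Rightarrow> nat) \<Rightarrow> (tabloid \<Rightarrow> 'k) \<Rightarrow> tabloid \<Rightarrow> 'k" where
  "perm_act \<sigma> v = (\<lambda>T. v ((\<lambda>t. inv' \<sigma> \<circ> t) ` T))"

definition polytabloid :: "nat list \<Rightarrow> (nat \<times> nat \<Rightarrow> nat) \<Rightarrow> tabloid \<Rightarrow> 'k::field" where
  "polytabloid lam t =
     (\<Sum>p\<in>column_stabilizer lam t. fscale (of_int (sign p)) (tabloid_vec lam (p \<circ> t)))"

definition specht_module :: "nat list \<Rightarrow> (tabloid \<Rightarrow> 'k::field) set" where
  "specht_module lam = fun_vs.span (polytabloid lam ` tableaux lam)"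

definition specht_character :: "nat list \<Rightarrow> (nat \<Rightarrow> nat) \<Rightarrow> 'k::field_char_0" where
  "specht_character lam \<sigma> = trace_on (specht_module lam) (perm_act \<sigma>)"


text \<open>The Specht module is a finite-dimensional subrepresentation.\<close>

lemma linear_perm_act: "Vector_Spaces.linear fscale fscale (perm_act \<sigma>)"
  by unfold_locales (auto simp: perm_act_def fscale_def fun_eq_iff algebra_simps)

lemma tableaux_comp:
  assumes "\<sigma> permutes {1..sum_list lam}" "t \<in> tableaux lam"
  shows "\<sigma> \<circ> t \<in> tableaux lam"
proof -
  have "bij_betw (\<sigma> \<circ> t) (young_diagram lam) {1..sum_list lam}"
    using assms permutes_imp_bij by (auto simp: tableaux_def intro: bij_betw_trans)
  moreover have "\<sigma> 0 = 0" using assms(1) by (auto simp: permutes_def)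
  ultimately show ?thesis using assms(2) by (auto simp: tableaux_def)
qed

lemma row_entries_comp: "row_entries lam (\<sigma> \<circ> t) i = \<sigma> ` row_entries lam t i"
  by (simp add: row_entries_def image_comp)

lemma col_entries_comp: "col_entries lam (\<sigma> \<circ> t) j = \<sigma> ` col_entries lam t j"
  by (simp add: col_entries_def image_comp)

lemma tabloid_of_comp:
  assumes "\<sigma> permutes {1..sum_list lam}"
  shows "(\<lambda>s. \<sigma> \<circ> s) ` tabloid_of lam t = tabloid_of lam (\<sigma> \<circ> t)"
proof (intro equalityI subsetI)
  fix s assume s: "s \<in> tabloid_of lam (\<sigma> \<circ> t)"
  have i: "inv' \<sigma> permutes {1..sum_list lam}" using assms by (rule permutes_inv)
  have inj: "inj \<sigma>" using assms by (rule permutes_inj)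
  have "inv' \<sigma> \<circ> s \<in> tabloid_of lam t"
    using s tableaux_comp[OF i] inj
    by (auto simp: tabloid_of_def row_entries_comp image_comp image_inv_f_f)
  moreover have "\<sigma> \<circ> (inv' \<sigma> \<circ> s) = s"
    using permutes_inv_o(1)[OF assms] by (metis comp_assoc id_comp)
  ultimately show "s \<in> (\<lambda>s. \<sigma> \<circ> s) ` tabloid_of lam t" by (metis image_eqI)
qed (use tableaux_comp[OF assms] in \<open>auto simp: tabloid_of_def row_entries_comp\<close>)

lemma perm_act_tabloid_vec:
  assumes "\<sigma> permutes {1..sum_list lam}"
  shows "perm_act \<sigma> (tabloid_vec lam t :: tabloid \<Rightarrow> 'k::field) = tabloid_vec lam (\<sigma> \<circ> t)"
proof
  fix T :: tabloid
  have "(\<lambda>s. inv' \<sigma> \<circ> s) ` T = tabloid_of lam t \<longleftrightarrow> T = tabloid_of lam (\<sigma> \<circ> t)"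
  proof
    assume "(\<lambda>s. inv' \<sigma> \<circ> s) ` T = tabloid_of lam t"
    then have "(\<lambda>s. \<sigma> \<circ> s) ` (\<lambda>s. inv' \<sigma> \<circ> s) ` T = tabloid_of lam (\<sigma> \<circ> t)"
      using tabloid_of_comp[OF assms] by simp
    then show "T = tabloid_of lam (\<sigma> \<circ> t)"
      using permutes_inv_o(1)[OF assms] by (simp add: image_comp o_def fun_eq_iff)
  next
    assume "T = tabloid_of lam (\<sigma> \<circ> t)"
    then show "(\<lambda>s. inv' \<sigma> \<circ> s) ` T = tabloid_of lam t"
      using tabloid_of_comp[OF permutes_inv[OF assms], of "\<sigma> \<circ> t"] permutes_inv_o(2)[OF assms]
      by (simp add: comp_assoc[symmetric])
  qed
  then show "perm_act \<sigma> (tabloid_vec lam t :: tabloid \<Rightarrow> 'k) T = tabloid_vec lam (\<sigma> \<circ> t) T"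
    by (simp add: perm_act_def tabloid_vec_def)
qed

lemma perm_act_polytabloid:
  assumes \<sigma>: "\<sigma> permutes {1..sum_list lam}"
  shows "perm_act \<sigma> (polytabloid lam t :: tabloid \<Rightarrow> 'k::field) = polytabloid lam (\<sigma> \<circ> t)"
proof -
  interpret L: Vector_Spaces.linear fscale fscale "perm_act \<sigma> :: (tabloid \<Rightarrow> 'k) \<Rightarrow> _"
    by (rule linear_perm_act)
  define g where "g p = \<sigma> \<circ> p \<circ> inv' \<sigma>" for p
  define h where "h p = inv' \<sigma> \<circ> p \<circ> \<sigma>" for p
  have i: "inv' \<sigma> permutes {1..sum_list lam}" using \<sigma> by (rule permutes_inv)
  have s1: "\<sigma> (inv' \<sigma> x) = x" and s2: "inv' \<sigma> (\<sigma> x) = x" for x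
    using permutes_inverses[OF \<sigma>] by auto
  have gC: "g p \<in> column_stabilizer lam (\<sigma> \<circ> t)" if "p \<in> column_stabilizer lam t" for p
  proof -
    have "g p permutes {1..sum_list lam}"
      using that \<sigma> i unfolding g_def
      by (auto simp: column_stabilizer_def sym_group_carrier intro!: permutes_compose)
    moreover have "g p ` \<sigma> ` A = \<sigma> ` p ` A" for A
      by (simp add: g_def image_comp o_def s2)
    ultimately show ?thesis using that
      by (simp add: column_stabilizer_def sym_group_carrier col_entries_comp)
  qed
  have hC: "h p \<in> column_stabilizer lam t" if "p \<in> column_stabilizer lam (\<sigma> \<circ> t)" for p
  proof -
    have "h p permutes {1..sum_list lam}"
      using that \<sigma> i unfolding h_def
      by (auto simp: column_stabilizer_def sym_group_carrier intro!: permutes_compose)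
    moreover have "h p ` A = inv' \<sigma> ` p ` \<sigma> ` A" "inv' \<sigma> ` \<sigma> ` A = A" for A
      by (simp_all add: h_def image_comp o_def s2)
    ultimately show ?thesis using that
      by (simp add: column_stabilizer_def sym_group_carrier col_entries_comp)
  qed
  have sgn: "sign (g p) = sign p" if "p \<in> column_stabilizer lam t" for p
  proof -
    have "permutation p" "permutation \<sigma>" "permutation (inv' \<sigma>)"
      using that \<sigma> i by (auto simp: column_stabilizer_def sym_group_carrier permutation_permutes)
    then show ?thesis
      by (simp add: g_def sign_compose permutation_compose sign_inverse mult.commute
                    mult.left_commute[of "sign \<sigma>"])
  qed
  have "perm_act \<sigma> (polytabloid lam t :: tabloid \<Rightarrow> 'k) =
      (\<Sum>p\<in>column_stabilizer lam t. fscale (of_int (sign p)) (tabloid_vec lam (\<sigma> \<circ> (p \<circ> t))))"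
    by (simp add: polytabloid_def L.sum L.scale perm_act_tabloid_vec[OF \<sigma>])
  also have "\<dots> = polytabloid lam (\<sigma> \<circ> t)"
    unfolding polytabloid_def
  proof (rule sum.reindex_bij_witness[of _ h g])
    fix p assume "p \<in> column_stabilizer lam t"
    then show "h (g p) = p" "g p \<in> column_stabilizer lam (\<sigma> \<circ> t)"
      "fscale (of_int (sign (g p))) (tabloid_vec lam (g p \<circ> (\<sigma> \<circ> t))) =
       fscale (of_int (sign p)) (tabloid_vec lam (\<sigma> \<circ> (p \<circ> t)) :: tabloid \<Rightarrow> 'k)"
      using gC sgn by (simp_all add: g_def h_def o_def s2)
  next
    fix p assume "p \<in> column_stabilizer lam (\<sigma> \<circ> t)"
    then show "g (h p) = p" "h p \<in> column_stabilizer lam t"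
      using hC by (simp_all add: g_def h_def o_def s1)
  qed
  finally show ?thesis .
qed

lemma perm_act_specht_module:
  assumes "\<sigma> permutes {1..sum_list lam}"
  shows "perm_act \<sigma> ` (specht_module lam :: (tabloid \<Rightarrow> 'k::field) set) \<subseteq> specht_module lam"
proof -
  interpret L: Vector_Spaces.linear fscale fscale "perm_act \<sigma> :: (tabloid \<Rightarrow> 'k) \<Rightarrow> _"
    by (rule linear_perm_act)
  have "perm_act \<sigma> ` (polytabloid lam ` tableaux lam :: (tabloid \<Rightarrow> 'k) set)
          \<subseteq> polytabloid lam ` tableaux lam"
    using perm_act_polytabloid[OF assms] tableaux_comp[OF assms] by auto
  then show ?thesis
    unfolding specht_module_def by (simp add: L.span_image[symmetric] fun_vs.span_mono)
qed

lemma finite_tableaux: "finite (tableaux lam)"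
proof -
  have "young_diagram lam \<subseteq> (SIGMA i:{..<length lam}. {..<lam ! i})"
    by (auto simp: young_diagram_def)
  then have "finite (young_diagram lam)" by (rule finite_subset) simp
  then have "finite {t. \<forall>c. (c \<in> young_diagram lam \<longrightarrow> t c \<in> {1..sum_list lam}) \<and>
                            (c \<notin> young_diagram lam \<longrightarrow> t c = 0)}"
    by (intro finite_set_of_finite_funs) auto
  then show ?thesis
    by (rule rev_finite_subset) (auto simp: tableaux_def dest: bij_betwE)
qed

lemma specht_module_basis:
  "\<exists>B. finite B \<and> fun_vs.independent B \<and>
       fun_vs.span B = (specht_module lam :: (tabloid \<Rightarrow> 'k::field) set)"
proof -
  let ?P = "polytabloid lam ` tableaux lam :: (tabloid \<Rightarrow> 'k) set"
  obtain B where B: "B \<subseteq> ?P" "fun_vs.independent B" "?P \<subseteq> fun_vs.span B"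
    by (rule fun_vs.maximal_independent_subset)
  have "fun_vs.span B = fun_vs.span ?P"
    using B(1,3) fun_vs.span_mono[OF B(1)] fun_vs.span_minimal[OF B(3) fun_vs.subspace_span]
    by (intro equalityI)
  moreover have "finite B"
    using B(1) finite_tableaux by (auto intro: finite_subset)
  ultimately show ?thesis using B(2) unfolding specht_module_def by blast
qed


section \<open>Sets of permutations\<close>

text \<open>Library \<open>cycle_of_list\<close> maps the empty list to the identity, hence \<open>cs \<noteq> []\<close>.\<close>

definition even_length_cycles :: "nat \<Rightarrow> (nat \<Rightarrow> nat) set" where
  "even_length_cycles n =
     {cycle_of_list cs |cs. cycle cs \<and> set cs \<subseteq> {1..n} \<and> cs \<noteq> [] \<and> even (length cs)}"

definition Z_set :: "nat \<Rightarrow> nat \<Rightarrow> (nat \<Rightarrow> nat) set" where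
  "Z_set l n =
     {cycle_of_list [1..<2 * j + 1] |j. 1 \<le> j \<and> 2 * j \<le> n \<and> \<not> l dvd j} \<union>
     {cycle_of_list [1..<2 * k * l] \<circ> cycle_of_list [2 * k * l, 2 * k * l + 1] |k.
        1 \<le> k \<and> 1 < 2 * k * l \<and> 2 * k * l < n}"

definition odd_regular_elements :: "nat \<Rightarrow> nat \<Rightarrow> (nat \<Rightarrow> nat) set" where
  "odd_regular_elements l n =
     {p \<in> carrier (sym_group n). \<not> evenperm p \<and> \<not> l dvd group.ord (sym_group n) p}"

end

theory Submission
  imports Defs
begin

text \<open>
  Write \<open>\<chi>\<close> for the character of \<open>lam\<close>. All three conditions lead to (ii): the set \<open>Z_set l n\<close>
  consists of odd permutations of order not divisible by \<open>l\<close>, and for \<open>l > n\<close> it consists of cycles of even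
  length. From (ii) the proof goes on in two steps.

  The first step shows that \<open>\<chi>\<close> vanishes on every odd permutation. A sum over conjugates
  \<open>\<Sum>g. g a g\<inverse>\<close> is central and therefore acts as a scalar on the Specht module (\<open>conj_sum_scalar\<close>);
  so \<open>\<chi> a = 0\<close> implies \<open>\<Sum>g. \<chi> (g a g\<inverse> b) = 0\<close> for every \<open>b\<close> (\<open>character_sum_conjugates_eq_0\<close>).
  Induct on the number of points moved by an odd permutation. If it is a product of disjoint
  nontrivial \<open>a\<close> and \<open>b\<close> with \<open>a\<close> odd, then the summands are either conjugate to \<open>a b\<close> or move fewer
  points, whence \<open>\<chi> (a b) = 0\<close>. If it is a single cycle whose length is divisible by \<open>2 * l\<close>, the same
  argument is applied to a transposition \<open>a\<close> and a cycle \<open>b\<close> that is shorter by one; the summands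
  where the two are disjoint are the second kind of elements of \<open>Z_set l n\<close>. The other even cycles
  belong to the first kind. This is \<open>odd_eq_0\<close>.

  The second step deduces \<open>lam = conjugate lam\<close>. For a tableau \<open>t\<close> let \<open>\<kappa>\<close> be the signed sum over its
  column stabilizer and \<open>\<rho>\<close> the sum over its row stabilizer. The Young symmetrizer \<open>\<kappa> \<rho>\<close> has nonzero
  trace on the Specht module (\<open>trace_young_symmetrizer_nonzero\<close>). Since only even products
  contribute to this trace, it does not change when the signs are moved from the columns to the
  rows. So the signed row sum of \<open>t\<close> does not kill all tabloids, and the unsigned column sum does
  not kill all polytabloids. By the first fact some tableau of shape \<open>lam\<close> has no row that meets a
  row of \<open>t\<close> in two entries; by the second the same holds for columns and a second tableau. Counting as in the Gale--Ryser theorem gives two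
  opposite dominance inequalities between \<open>lam\<close> and its conjugate, hence equality
  (\<open>row_lengths_eq_column_lengths\<close>).
\<close>

section \<open>Traces on finite-dimensional function spaces\<close>

definition fin_dim :: "('x \<Rightarrow> 'k::field) set \<Rightarrow> bool" where
  "fin_dim V \<longleftrightarrow> (\<exists>B. finite B \<and> fun_vs.independent B \<and> fun_vs.span B = V)"

abbreviation fun_linear :: "(('x \<Rightarrow> 'k::field) \<Rightarrow> ('x \<Rightarrow> 'k)) \<Rightarrow> bool" where
  "fun_linear \<equiv> Vector_Spaces.linear fscale fscale"

lemma fun_linearI:
  assumes "\<And>u v. f (u + v) = f u + f v" "\<And>c v. f (fscale c v) = fscale c (f v)"
  shows "fun_linear f"
  by unfold_locales (use assms in auto)

lemma fun_linear_comb: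
  fixes f :: "'i \<Rightarrow> ('x \<Rightarrow> 'k::field) \<Rightarrow> ('x \<Rightarrow> 'k)"
  assumes "\<And>i. i \<in> I \<Longrightarrow> fun_linear (f i)"
  shows "fun_linear (\<lambda>v. \<Sum>i\<in>I. fscale (w i) (f i v))"
proof (rule fun_linearI)
  fix u v :: "'x \<Rightarrow> 'k" and c
  have a: "f i (u + v) = f i u + f i v" "f i (fscale c v) = fscale c (f i v)" if "i \<in> I" for i
  proof -
    interpret L: Vector_Spaces.linear fscale fscale "f i" by (rule assms[OF that])
    show "f i (u + v) = f i u + f i v" "f i (fscale c v) = fscale c (f i v)"
      by (rule L.add, rule L.scale)
  qed
  show "(\<Sum>i\<in>I. fscale (w i) (f i (u + v))) =
      (\<Sum>i\<in>I. fscale (w i) (f i u)) + (\<Sum>i\<in>I. fscale (w i) (f i v))"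
    by (simp add: a fun_vs.scale_right_distrib sum.distrib)
  show "(\<Sum>i\<in>I. fscale (w i) (f i (fscale c v))) = fscale c (\<Sum>i\<in>I. fscale (w i) (f i v))"
    by (simp add: a fun_vs.scale_sum_right mult.commute)
qed

lemma trace_on_comb:
  assumes V: "fin_dim V"
    and f: "\<And>i. i \<in> I \<Longrightarrow> fun_linear (f i)" "\<And>i. i \<in> I \<Longrightarrow> f i ` V \<subseteq> V"
  shows "trace_on V (\<lambda>v. \<Sum>i\<in>I. fscale (w i) (f i v)) = (\<Sum>i\<in>I. w i * trace_on V (f i))"
proof -
  obtain B where B: "finite B" "fun_vs.independent B" "fun_vs.span B = V"
    using V unfolding fin_dim_def by blast
  have bV: "b \<in> V" if "b \<in> B" for b using that B(3) fun_vs.span_base by blast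
  have inv: "(\<lambda>v. \<Sum>i\<in>I. fscale (w i) (f i v)) ` V \<subseteq> V"
    using f(2) unfolding B(3)[symmetric]
    by (auto intro!: fun_vs.span_sum fun_vs.span_scale)
  have "fun_vs.representation B (\<Sum>i\<in>I. fscale (w i) (f i b)) b
      = (\<Sum>i\<in>I. w i * fun_vs.representation B (f i b) b)" if "b \<in> B" for b
  proof -
    have m: "f i b \<in> fun_vs.span B" if "i \<in> I" for i
      using f(2)[OF that] bV[OF \<open>b \<in> B\<close>] B(3) by blast
    have "fun_vs.representation B (\<Sum>i\<in>I. fscale (w i) (f i b)) b
        = (\<Sum>i\<in>I. fun_vs.representation B (fscale (w i) (f i b)) b)"
      by (subst fun_vs.representation_sum[OF B(2)]) (auto intro!: fun_vs.span_scale m)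
    also have "\<dots> = (\<Sum>i\<in>I. w i * fun_vs.representation B (f i b) b)"
      by (intro sum.cong refl) (simp add: fun_vs.representation_scale[OF B(2)] m)
    finally show ?thesis .
  qed
  then have "trace_on V (\<lambda>v. \<Sum>i\<in>I. fscale (w i) (f i v))
      = (\<Sum>b\<in>B. \<Sum>i\<in>I. w i * fun_vs.representation B (f i b) b)"
    using trace_on_eq[OF fun_linear_comb[of I f, OF f(1)] B inv] by simp
  also have "\<dots> = (\<Sum>i\<in>I. w i * trace_on V (f i))"
    by (subst sum.swap) (auto intro!: sum.cong simp: trace_on_eq[OF f(1) B f(2)] sum_distrib_left)
  finally show ?thesis .
qed

lemma trace_on_nonzeroD:
  assumes V: "fin_dim V" and f: "fun_linear f" and nz: "trace_on V f \<noteq> 0"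
  shows "\<exists>v\<in>V. f v \<noteq> 0"
proof (rule ccontr)
  assume "\<not> ?thesis"
  then have z: "f v = 0" if "v \<in> V" for v using that by blast
  obtain B where B: "finite B" "fun_vs.independent B" "fun_vs.span B = V"
    using V unfolding fin_dim_def by blast
  have bV: "b \<in> V" if "b \<in> B" for b using that B(3) fun_vs.span_base by blast
  have "f ` V \<subseteq> V" using z fun_vs.span_zero[of B] B(3) by auto
  then have "trace_on V f = 0"
    by (subst trace_on_eq[OF f B]) (auto simp: z bV fun_vs.representation_zero)
  with nz show False by blast
qed

lemma trace_on_scalar_eq_0:
  fixes V :: "('x \<Rightarrow> 'k::field_char_0) set"
  assumes V: "fin_dim V" and f: "fun_linear f"
    and c: "\<And>v. v \<in> V \<Longrightarrow> f v = fscale c v" and nz: "e \<in> V" "e \<noteq> 0" and 0: "trace_on V f = 0"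
  shows "c = 0"
proof -
  obtain B where B: "finite B" "fun_vs.independent B" "fun_vs.span B = V"
    using V unfolding fin_dim_def by blast
  have bV: "b \<in> V" if "b \<in> B" for b using that B(3) fun_vs.span_base by blast
  have inv: "f ` V \<subseteq> V" using c fun_vs.span_scale[of _ B] B(3) by auto
  have r: "fun_vs.representation B (f b) b = c" if "b \<in> B" for b
    using that by (simp add: c bV fun_vs.representation_scale[OF B(2)] B(3)
        fun_vs.representation_basis[OF B(2)])
  have "of_nat (card B) * c = 0"
    using 0 trace_on_eq[OF f B inv] r by simp
  moreover have "card B \<noteq> 0" using B nz by auto
  ultimately show ?thesis by simp
qed

text \<open>
  In a basis of \<open>V\<close> that contains \<open>e\<close>, only the diagonal entry at \<open>e\<close> can be nonzero.
\<close>

lemma trace_on_line: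
  assumes V: "fin_dim V" and f: "fun_linear f" and e: "e \<in> V" "e \<noteq> 0"
    and line: "\<And>v. v \<in> V \<Longrightarrow> \<exists>a. f v = fscale a e" and c: "f e = fscale c e"
  shows "trace_on V f = c"
proof -
  obtain B0 where B0: "finite B0" "fun_vs.independent B0" "fun_vs.span B0 = V"
    using V unfolding fin_dim_def by blast
  have "fun_vs.independent {e}" using e(2) by (simp add: fun_vs.dependent_single)
  then obtain B where B: "{e} \<subseteq> B" "B \<subseteq> V" "fun_vs.independent B" "V \<subseteq> fun_vs.span B"
    using fun_vs.maximal_independent_subset_extend[of "{e}" V] e(1) by auto
  have fB: "finite B" using fun_vs.independent_span_bound[OF B0(1) B(3)] B(2) B0(3) by auto
  have sB: "fun_vs.span B = V"
    using fun_vs.span_mono[OF B(2)] B(4) fun_vs.span_span[of B0] B0(3) by (metis subset_antisym)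
  have "f ` V \<subseteq> V" using line e(1) fun_vs.span_scale[of e B] sB by force
  then have "trace_on V f = (\<Sum>b\<in>B. fun_vs.representation B (f b) b)"
    by (rule trace_on_eq[OF f fB B(3) sB])
  also have "\<dots> = (\<Sum>b\<in>B. if b = e then c else 0)"
  proof (intro sum.cong refl)
    fix b assume b: "b \<in> B"
    obtain a where a: "f b = fscale a e" using line[of b] b B(2) by blast
    have "fun_vs.representation B (f b) b = a * (if e = b then 1 else 0)"
      using B(1) b e sB
      by (simp add: a fun_vs.representation_scale[OF B(3)] fun_vs.representation_basis[OF B(3)])
    moreover have "a = c" if "b = e" using a c that e(2) by auto
    ultimately show "fun_vs.representation B (f b) b = (if b = e then c else 0)" by auto
  qed
  also have "\<dots> = c" using fB B(1) by simp
  finally show ?thesis .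
qed

text \<open>
  Both sides expand in a basis to the same double sum \<open>\<Sum>b c. g c b * f b c\<close> of matrix entries.
\<close>

lemma trace_on_comp_commute:
  assumes V: "fin_dim V" and f: "fun_linear f" "f ` V \<subseteq> V" and g: "fun_linear g" "g ` V \<subseteq> V"
  shows "trace_on V (f \<circ> g) = trace_on V (g \<circ> f)"
proof -
  obtain B where B: "finite B" "fun_vs.independent B" "fun_vs.span B = V"
    using V unfolding fin_dim_def by blast
  have bV: "b \<in> V" if "b \<in> B" for b using that B(3) fun_vs.span_base by blast
  let ?r = "\<lambda>v b. fun_vs.representation B v b"
  have *: "trace_on V (f \<circ> g) = (\<Sum>b\<in>B. \<Sum>c\<in>B. ?r (g b) c * ?r (f c) b)"
    if f: "fun_linear f" "f ` V \<subseteq> V" and g: "fun_linear g" "g ` V \<subseteq> V" for f g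
  proof -
    interpret f: Vector_Spaces.linear fscale fscale f by (rule f(1))
    have "?r (f (g b)) b = (\<Sum>c\<in>B. ?r (g b) c * ?r (f c) b)" if "b \<in> B" for b
    proof -
      have "g b \<in> fun_vs.span B" using g(2) bV[OF that] B(3) by blast
      then have "g b = (\<Sum>c\<in>B. fscale (?r (g b) c) c)"
        using fun_vs.sum_representation_eq[OF B(2) _ B(1) order_refl] by simp
      then have "f (g b) = (\<Sum>c\<in>B. fscale (?r (g b) c) (f c))"
        by (metis (no_types, lifting) f.sum f.scale sum.cong)
      then have "?r (f (g b)) b = ?r (\<Sum>c\<in>B. fscale (?r (g b) c) (f c)) b" by simp
      also have "\<dots> = (\<Sum>c\<in>B. ?r (fscale (?r (g b) c) (f c)) b)"
        using f(2) bV B(3)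
        by (subst fun_vs.representation_sum[OF B(2)]) (auto intro!: fun_vs.span_scale)
      also have "\<dots> = (\<Sum>c\<in>B. ?r (g b) c * ?r (f c) b)"
        using f(2) bV B(3)
        by (intro sum.cong refl) (subst fun_vs.representation_scale[OF B(2)], auto)
      finally show ?thesis .
    qed
    moreover have "fun_linear (f \<circ> g)" by (rule Vector_Spaces.linear_compose[OF g(1) f(1)])
    moreover have "(f \<circ> g) ` V \<subseteq> V" using f(2) g(2) by auto
    ultimately show ?thesis using trace_on_eq[of "f \<circ> g", OF _ B] by simp
  qed
  show ?thesis
    unfolding *[OF f g] *[OF g f] by (subst sum.swap) (simp add: mult.commute)
qed


section \<open>Counting boxes of a diagram with top-justified columns\<close>

lemma card_fibres:
  assumes "finite A" "finite J" "g ` A \<subseteq> J"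
  shows "card A = (\<Sum>j\<in>J. card {a \<in> A. g a = j})"
  using sum.group[OF assms, of "\<lambda>_. 1::nat"] by simp

text \<open>
  The elements of \<open>X\<close> are spread over columns (by \<open>g\<close>) as the boxes of \<open>D\<close> are, and each has a
  row (by \<open>f\<close>). In a single column the rows are distinct, so at most \<open>k\<close> elements lie in the rows
  below \<open>k\<close>; a top-justified column of \<open>D\<close> attains the bound \<open>min k h\<close>, \<open>h\<close> being its height.
\<close>

lemma count_fibre_le:
  fixes f g :: "'a \<Rightarrow> nat"
  assumes X: "finite X" "inj_on (\<lambda>x. (f x, g x)) X" and D: "finite D"
    and down: "\<And>i i' j. (i, j) \<in> D \<Longrightarrow> i' \<le> i \<Longrightarrow> (i', j) \<in> D"
    and col: "card {x \<in> X. g x = j} = card {c \<in> D. snd c = j}"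
  shows "card {x \<in> {x \<in> X. f x < k}. g x = j} \<le> card {c \<in> {c \<in> D. fst c < k}. snd c = j}"
proof (cases "\<exists>i\<ge>k. (i, j) \<in> D")
  case True
  then obtain i where "k \<le> i" "(i, j) \<in> D" by blast
  then have "(i', j) \<in> D" if "i' < k" for i'
    using down[of i j i'] that by linarith
  then have "(\<lambda>i. (i, j)) ` {..<k} \<subseteq> {c \<in> {c \<in> D. fst c < k}. snd c = j}"
    by auto
  then have "card ((\<lambda>i. (i, j)) ` {..<k}) \<le> card {c \<in> {c \<in> D. fst c < k}. snd c = j}"
    using D by (intro card_mono) auto
  moreover have "card ((\<lambda>i. (i, j)) ` {..<k}) = k"
    by (subst card_image) (auto simp: inj_on_def)
  moreover have "card {x \<in> {x \<in> X. f x < k}. g x = j} \<le> card {..<k}"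
    using X(2) by (intro card_inj_on_le[of f]) (auto simp: inj_on_def)
  ultimately show ?thesis by simp
next
  case False
  then have "i < k" if "(i, j) \<in> D" for i
    using that not_le by blast
  then have "{c \<in> {c \<in> D. fst c < k}. snd c = j} = {c \<in> D. snd c = j}"
    by auto
  moreover have "card {x \<in> {x \<in> X. f x < k}. g x = j} \<le> card {x \<in> X. g x = j}"
    using X(1) by (intro card_mono) auto
  ultimately show ?thesis using col by simp
qed

text \<open>
  With the rows and columns of two tableaux for \<open>f\<close> and \<open>g\<close> this is the inequality of partial sums
  (dominance order) in the Gale--Ryser theorem: \<open>X\<close> is a 0-1 matrix whose column sums are the column
  lengths of \<open>D\<close>.
\<close>

lemma count_below_le:
  fixes f g :: "'a \<Rightarrow> nat"
  assumes X: "finite X" "inj_on (\<lambda>x. (f x, g x)) X" and D: "finite D"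
    and down: "\<And>i i' j. (i, j) \<in> D \<Longrightarrow> i' \<le> i \<Longrightarrow> (i', j) \<in> D"
    and col: "\<And>j. card {x \<in> X. g x = j} = card {c \<in> D. snd c = j}"
  shows "card {x \<in> X. f x < k} \<le> card {c \<in> D. fst c < k}"
proof -
  let ?J = "g ` X \<union> snd ` D"
  have "card {x \<in> X. f x < k} = (\<Sum>j\<in>?J. card {x \<in> {x \<in> X. f x < k}. g x = j})"
    using X D by (intro card_fibres) auto
  also have "\<dots> \<le> (\<Sum>j\<in>?J. card {c \<in> {c \<in> D. fst c < k}. snd c = j})"
    by (intro sum_mono count_fibre_le X D col) (rule down)
  also have "\<dots> = card {c \<in> D. fst c < k}"
    using X D by (intro card_fibres[symmetric]) auto
  finally show ?thesis .
qed

text \<open>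
  The extreme case of the previous inequality. Equality of the totals forces equality in every
  column, so each column is filled without gaps from row \<open>0\<close> on.
\<close>

lemma count_below_eq:
  fixes f g :: "'a \<Rightarrow> nat"
  assumes X: "finite X" "inj_on (\<lambda>x. (f x, g x)) X" and D: "finite D"
    and down: "\<And>i i' j. (i, j) \<in> D \<Longrightarrow> i' \<le> i \<Longrightarrow> (i', j) \<in> D"
    and col: "\<And>j. card {x \<in> X. g x = j} = card {c \<in> D. snd c = j}"
    and row: "\<And>k. card {x \<in> X. f x < k} = card {c \<in> D. fst c < k}"
    and x: "x \<in> X"
  shows "(f x, g x) \<in> D"
proof (rule ccontr)
  assume out: "(f x, g x) \<notin> D"
  let ?J = "g ` X \<union> snd ` D" and ?k = "f x" and ?j = "g x"
  have le: "card {y \<in> {y \<in> X. f y < ?k}. g y = j} \<le> card {c \<in> {c \<in> D. fst c < ?k}. snd c = j}" for j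
    by (intro count_fibre_le X D col) (rule down)
  \<comment> \<open>A box of column \<open>?j\<close> in row \<open>?k\<close> or later would put the missing box into \<open>D\<close>.\<close>
  have lt: "i < ?k" if "(i, ?j) \<in> D" for i
    using down[OF that, of ?k] out by (meson not_le)
  have "(\<Sum>j\<in>?J. card {x \<in> {x \<in> X. f x < ?k}. g x = j}) = card {x \<in> X. f x < ?k}"
    using X D by (intro card_fibres[symmetric]) auto
  also have "\<dots> = (\<Sum>j\<in>?J. card {c \<in> {c \<in> D. fst c < ?k}. snd c = j})"
    unfolding row using X D by (intro card_fibres) auto
  finally have sums: "(\<Sum>j\<in>?J. card {x \<in> {x \<in> X. f x < ?k}. g x = j})
      = (\<Sum>j\<in>?J. card {c \<in> {c \<in> D. fst c < ?k}. snd c = j})" .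
  have "card {y \<in> {y \<in> X. f y < ?k}. g y = ?j} = card {c \<in> {c \<in> D. fst c < ?k}. snd c = ?j}"
    by (rule sum_mono_inv[OF sums le]) (use X(1) D x in auto)
  also have "{c \<in> {c \<in> D. fst c < ?k}. snd c = ?j} = {c \<in> D. snd c = ?j}"
    using lt by auto
  also have "card \<dots> = card {y \<in> X. g y = ?j}" by (rule col[symmetric])
  finally have "card {y \<in> {y \<in> X. f y < ?k}. g y = ?j} = card {y \<in> X. g y = ?j}" .
  moreover have "card {y \<in> {y \<in> X. f y < ?k}. g y = ?j} < card {y \<in> X. g y = ?j}"
    using X(1) x by (intro psubset_card_mono) auto
  ultimately show False by simp
qed


section \<open>Tableaux, tabloids and stabilizers\<close>

lemma finite_young_diagram: "finite (young_diagram lam)"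
proof -
  have "young_diagram lam \<subseteq> (SIGMA i:{..<length lam}. {..<lam ! i})"
    by (auto simp: young_diagram_def)
  then show ?thesis by (rule finite_subset) simp
qed

lemma young_diagram_down:
  assumes "sorted_wrt (\<ge>) lam" "(i, j) \<in> young_diagram lam" "i' \<le> i" "j' \<le> j"
  shows "(i', j') \<in> young_diagram lam"
proof -
  have "lam ! i \<le> lam ! i'"
    using assms by (cases "i' = i") (auto simp: young_diagram_def sorted_wrt_iff_nth_less)
  then show ?thesis using assms by (auto simp: young_diagram_def)
qed

text \<open>
  The inverse of a tableau; rows and columns of entries are read off from it.
\<close>

definition box_of :: "nat list \<Rightarrow> (nat \<times> nat \<Rightarrow> nat) \<Rightarrow> nat \<Rightarrow> nat \<times> nat" where
  "box_of lam t x = inv_into (young_diagram lam) t x"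

context
  fixes lam t
  assumes t: "t \<in> tableaux lam"
begin

lemma tableau_bij: "bij_betw t (young_diagram lam) {1..sum_list lam}"
  using t by (simp add: tableaux_def)

lemma box_of_in: "x \<in> {1..sum_list lam} \<Longrightarrow> box_of lam t x \<in> young_diagram lam"
  unfolding box_of_def using tableau_bij by (metis bij_betw_def inv_into_into)

lemma tableau_box_of [simp]: "x \<in> {1..sum_list lam} \<Longrightarrow> t (box_of lam t x) = x"
  unfolding box_of_def using tableau_bij by (metis bij_betw_inv_into_right)

lemma box_of_tableau [simp]: "c \<in> young_diagram lam \<Longrightarrow> box_of lam t (t c) = c"
  unfolding box_of_def using tableau_bij by (metis bij_betw_inv_into_left)

lemma tableau_in: "c \<in> young_diagram lam \<Longrightarrow> t c \<in> {1..sum_list lam}"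
  using tableau_bij by (auto simp: bij_betw_def)

lemma row_entries_box: "row_entries lam t i = {x \<in> {1..sum_list lam}. fst (box_of lam t x) = i}"
proof (intro equalityI subsetI)
  fix x assume "x \<in> {x \<in> {1..sum_list lam}. fst (box_of lam t x) = i}"
  then show "x \<in> row_entries lam t i"
    unfolding row_entries_def using box_of_in[of x] tableau_box_of[of x]
    by (intro image_eqI[of _ _ "box_of lam t x"]) simp_all
qed (use tableau_in in \<open>auto simp: row_entries_def simp del: atLeastAtMost_iff\<close>)

lemma col_entries_box: "col_entries lam t j = {x \<in> {1..sum_list lam}. snd (box_of lam t x) = j}"
proof (intro equalityI subsetI)
  fix x assume "x \<in> {x \<in> {1..sum_list lam}. snd (box_of lam t x) = j}"
  then show "x \<in> col_entries lam t j"
    unfolding col_entries_def using box_of_in[of x] tableau_box_of[of x]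
    by (intro image_eqI[of _ _ "box_of lam t x"]) simp_all
qed (use tableau_in in \<open>auto simp: col_entries_def simp del: atLeastAtMost_iff\<close>)

lemma card_box_of: "card {x \<in> {1..sum_list lam}. P (box_of lam t x)} = card {c \<in> young_diagram lam. P c}"
proof -
  have "bij_betw t {c \<in> young_diagram lam. P c} {x \<in> {1..sum_list lam}. P (box_of lam t x)}"
    by (intro bij_betw_byWitness[where f' = "box_of lam t"])
      (use tableau_in box_of_in in \<open>auto simp del: atLeastAtMost_iff\<close>)
  then show ?thesis by (simp add: bij_betw_same_card)
qed

end

lemma box_of_comp:
  assumes "p permutes {1..sum_list lam}" "t \<in> tableaux lam" "x \<in> {1..sum_list lam}"
  shows "box_of lam (p \<circ> t) (p x) = box_of lam t x"
  using box_of_tableau[OF tableaux_comp[OF assms(1,2)] box_of_in[OF assms(2,3)]] assms by simp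

lemma tabloid_of_eq_iff:
  assumes "s \<in> tableaux lam" "t \<in> tableaux lam"
  shows "tabloid_of lam s = tabloid_of lam t \<longleftrightarrow>
    (\<forall>x\<in>{1..sum_list lam}. fst (box_of lam s x) = fst (box_of lam t x))"
proof -
  have "tabloid_of lam s = tabloid_of lam t \<longleftrightarrow> (\<forall>i. row_entries lam s i = row_entries lam t i)"
    using assms by (auto simp: tabloid_of_def)
  also have "\<dots> \<longleftrightarrow> (\<forall>x\<in>{1..sum_list lam}. fst (box_of lam s x) = fst (box_of lam t x))"
    unfolding row_entries_box[OF assms(1)] row_entries_box[OF assms(2)] set_eq_iff mem_Collect_eq
    by metis
  finally show ?thesis .
qed

text \<open>
  Row and column stabilizers are the two instances that occur; in both cases \<open>F\<close> lists the rows or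
  columns of a tableau.
\<close>

definition set_stabilizer :: "nat \<Rightarrow> (nat \<Rightarrow> nat set) \<Rightarrow> (nat \<Rightarrow> nat) set" where
  "set_stabilizer n F = {p. p permutes {1..n} \<and> (\<forall>i. p ` F i = F i)}"

lemma column_stabilizer_eq:
  "column_stabilizer lam t = set_stabilizer (sum_list lam) (col_entries lam t)"
  by (simp add: column_stabilizer_def set_stabilizer_def sym_group_carrier)

lemma finite_set_stabilizer: "finite (set_stabilizer n F)"
  by (rule finite_subset[OF _ finite_permutations[of "{1..n}"]]) (auto simp: set_stabilizer_def)

lemma set_stabilizer_permutes: "p \<in> set_stabilizer n F \<Longrightarrow> p permutes {1..n}"
  by (simp add: set_stabilizer_def)

lemma id_set_stabilizer: "id \<in> set_stabilizer n F"
  by (simp add: set_stabilizer_def permutes_id)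

lemma set_stabilizer_comp:
  "p \<in> set_stabilizer n F \<Longrightarrow> q \<in> set_stabilizer n F \<Longrightarrow> p \<circ> q \<in> set_stabilizer n F"
  unfolding set_stabilizer_def mem_Collect_eq by (metis image_comp permutes_compose)

lemma set_stabilizer_inv:
  assumes "p \<in> set_stabilizer n F"
  shows "inv' p \<in> set_stabilizer n F"
proof -
  have p: "p permutes {1..n}" and F: "p ` F i = F i" for i
    using assms by (auto simp: set_stabilizer_def)
  have "inv' p ` F i = F i" for i
    using F[of i] image_inv_f_f[OF permutes_inj[OF p], of "F i"] by simp
  then show ?thesis using permutes_inv[OF p] by (simp add: set_stabilizer_def)
qed

lemma bij_betw_set_stabilizer_comp:
  assumes "q \<in> set_stabilizer n F"
  shows "bij_betw (\<lambda>p. p \<circ> q) (set_stabilizer n F) (set_stabilizer n F)"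
proof -
  have q: "q permutes {1..n}" using assms by (rule set_stabilizer_permutes)
  show ?thesis
    by (rule bij_betw_byWitness[where f' = "\<lambda>p. p \<circ> inv' q"])
      (auto simp: comp_assoc permutes_inv_o[OF q] intro: set_stabilizer_comp set_stabilizer_inv assms)
qed

lemma transpose_set_stabilizer:
  assumes "x \<in> {1..n}" "y \<in> {1..n}" "\<And>i. x \<in> F i \<longleftrightarrow> y \<in> F i"
  shows "transpose x y \<in> set_stabilizer n F"
proof -
  have "transpose x y ` F i = F i" for i
    using assms(3)[of i] by (cases "x \<in> F i") (simp_all add: transpose_image_eq)
  then show ?thesis using permutes_swap_id[OF assms(1,2)] by (simp add: set_stabilizer_def)
qed

(* With the rewrite rule from 1 to Suc 0 the simplifier would alter the set {1..n} of points. *)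
declare One_nat_def [simp del]

lemma sum_fun_apply: "(\<Sum>i\<in>I. f i) x = (\<Sum>i\<in>I. f i x)" for f :: "'i \<Rightarrow> 'x \<Rightarrow> 'a::comm_monoid_add"
  by (induction I rule: infinite_finite_induct) simp_all

text \<open>
  James's basic combinatorial lemma: if no two entries share a row of \<open>s\<close> and a column of \<open>t\<close>,
  then permuting the columns of \<open>t\<close> turns its rows into those of \<open>s\<close>. Sending \<open>x\<close> to its row in
  \<open>s\<close> and its column in \<open>t\<close> is injective, and by \<open>count_below_eq\<close> it lands in the diagram; so it
  is a bijection onto the boxes, and reading \<open>t\<close> at these boxes is a column permutation.
\<close>

lemma column_stabilizer_straighten:
  assumes lam: "sorted_wrt (\<ge>) lam" and t: "t \<in> tableaux lam" and s: "s \<in> tableaux lam"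
    and inj: "inj_on (\<lambda>x. (fst (box_of lam s x), snd (box_of lam t x))) {1..sum_list lam}"
  shows "\<exists>p\<in>column_stabilizer lam t. tabloid_of lam (p \<circ> t) = tabloid_of lam s"
proof -
  let ?X = "{1..sum_list lam}" and ?D = "young_diagram lam"
  define F where "F x = (fst (box_of lam s x), snd (box_of lam t x))" for x
  have FD: "F x \<in> ?D" if "x \<in> ?X" for x
    unfolding F_def
  proof (rule count_below_eq[OF _ inj finite_young_diagram _ _ _ that])
    show "finite ?X" by simp
    show "(i', j) \<in> ?D" if "(i, j) \<in> ?D" "i' \<le> i" for i i' j
      using young_diagram_down[OF lam that(1,2)] by blast
    show "card {x \<in> ?X. snd (box_of lam t x) = j} = card {c \<in> ?D. snd c = j}" for j
      by (rule card_box_of[OF t])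
    show "card {x \<in> ?X. fst (box_of lam s x) < k} = card {c \<in> ?D. fst c < k}" for k
      by (rule card_box_of[OF s])
  qed
  \<comment> \<open>The straightening permutation is the inverse of \<open>q\<close>, which takes \<open>s\<close> to the tabloid of \<open>t\<close>.\<close>
  define q where "q x = (if x \<in> ?X then t (F x) else x)" for x
  have q: "q permutes ?X"
  proof (rule bij_imp_permutes)
    have "inj_on q ?X"
    proof (rule inj_onI)
      fix x y assume xy: "x \<in> ?X" "y \<in> ?X" and "q x = q y"
      then have "t (F x) = t (F y)" by (simp add: q_def)
      then have "F x = F y" using box_of_tableau[OF t] FD xy by metis
      then show "x = y" using inj_onD[OF inj _ xy] unfolding F_def by blast
    qed
    moreover have "q ` ?X \<subseteq> ?X" using tableau_in[OF t, OF FD] by (auto simp: q_def simp del: atLeastAtMost_iff)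
    ultimately show "bij_betw q ?X ?X" by (simp add: bij_betw_def endo_inj_surj)
    show "q x = x" if "x \<notin> ?X" for x using that by (simp only: q_def if_False)
  qed
  have qX: "q x \<in> ?X" if "x \<in> ?X" for x using that permutes_in_image[OF q] by blast
  have bq: "box_of lam t (q x) = F x" if "x \<in> ?X" for x
    using that FD[OF that] box_of_tableau[OF t] by (simp add: q_def)
  have "q ` col_entries lam t j = col_entries lam t j" for j
  proof (rule card_subset_eq)
    show "finite (col_entries lam t j)" by (simp add: col_entries_box[OF t])
    show "q ` col_entries lam t j \<subseteq> col_entries lam t j"
      unfolding col_entries_box[OF t] using bq qX by (auto simp: F_def simp del: atLeastAtMost_iff)
    show "card (q ` col_entries lam t j) = card (col_entries lam t j)"
      by (rule card_image) (rule permutes_inj_on[OF q])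
  qed
  then have qC: "q \<in> column_stabilizer lam t"
    using q by (simp add: column_stabilizer_eq set_stabilizer_def)
  have "tabloid_of lam (q \<circ> s) = tabloid_of lam t"
    unfolding tabloid_of_eq_iff[OF tableaux_comp[OF q s] t]
  proof
    fix x assume x: "x \<in> ?X"
    define y where "y = inv' q x"
    have y: "y \<in> ?X" "x = q y"
      using x permutes_in_image[OF permutes_inv[OF q]] permutes_inverses(1)[OF q]
      unfolding y_def by (blast, simp)
    show "fst (box_of lam (q \<circ> s) x) = fst (box_of lam t x)"
      unfolding y(2) box_of_comp[OF q s y(1)] bq[OF y(1)] by (simp add: F_def)
  qed
  then have "(\<lambda>u. inv' q \<circ> u) ` tabloid_of lam (q \<circ> s) = (\<lambda>u. inv' q \<circ> u) ` tabloid_of lam t" by simp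
  then have "tabloid_of lam (inv' q \<circ> (q \<circ> s)) = tabloid_of lam (inv' q \<circ> t)"
    by (simp only: tabloid_of_comp[OF permutes_inv[OF q]])
  moreover have "inv' q \<circ> (q \<circ> s) = s" using permutes_inv_o(2)[OF q] by (simp add: comp_assoc[symmetric])
  ultimately show ?thesis
    using set_stabilizer_inv qC unfolding column_stabilizer_eq by metis
qed

lemma exists_tableau: "\<exists>t. t \<in> tableaux lam"
proof -
  have "young_diagram lam = (SIGMA i:{..<length lam}. {..<lam ! i})"
    by (auto simp: young_diagram_def)
  then have "card (young_diagram lam) = card {1..sum_list lam}"
    by (simp add: sum_list_sum_nth atLeast0LessThan)
  then obtain h where h: "bij_betw h (young_diagram lam) {1..sum_list lam}"
    using finite_same_card_bij[OF finite_young_diagram] by (metis finite_atLeastAtMost)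
  define t where "t c = (if c \<in> young_diagram lam then h c else 0)" for c
  have "bij_betw t (young_diagram lam) {1..sum_list lam}"
    using h by (rule bij_betw_cong[THEN iffD1, rotated]) (simp add: t_def)
  then show ?thesis by (auto simp: tableaux_def t_def)
qed

lemma tableaux_transitive:
  assumes s: "s \<in> tableaux lam" and t: "t \<in> tableaux lam"
  shows "\<exists>p. p permutes {1..sum_list lam} \<and> s = p \<circ> t"
proof -
  let ?X = "{1..sum_list lam}"
  define p where "p x = (if x \<in> ?X then s (box_of lam t x) else x)" for x
  have "bij_betw (box_of lam t) ?X (young_diagram lam)"
    unfolding box_of_def using tableau_bij[OF t] by (rule bij_betw_inv_into)
  then have "bij_betw (\<lambda>x. s (box_of lam t x)) ?X ?X"
    using bij_betw_trans[OF _ tableau_bij[OF s]] by (simp add: o_def)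
  then have "bij_betw p ?X ?X"
    by (rule bij_betw_cong[THEN iffD1, rotated]) (simp add: p_def)
  then have "p permutes ?X" by (rule bij_imp_permutes) (simp only: p_def if_False)
  moreover have "s c = p (t c)" for c
  proof (cases "c \<in> young_diagram lam")
    case True
    then show ?thesis using tableau_in[OF t] box_of_tableau[OF t] by (simp add: p_def)
  next
    case False
    then have "s c = 0" "t c = 0" using s t unfolding tableaux_def by blast+
    then show ?thesis by (simp add: p_def)
  qed
  ultimately show ?thesis by (intro exI[of _ p]) auto
qed


section \<open>Linear combinations of permutations acting on tabloids\<close>

lemma perm_act_comp:
  assumes "bij p" "bij q"
  shows "perm_act p (perm_act q v) = perm_act (p \<circ> q) v"
  by (simp add: perm_act_def fun_eq_iff o_inv_distrib[OF assms] image_image o_assoc)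

text \<open>
  The action of the group algebra element \<open>\<Sum>p\<in>P. w p * p\<close>.
\<close>

definition perm_comb :: "(nat \<Rightarrow> nat) set \<Rightarrow> ((nat \<Rightarrow> nat) \<Rightarrow> 'k::field) \<Rightarrow> (tabloid \<Rightarrow> 'k) \<Rightarrow> tabloid \<Rightarrow> 'k" where
  "perm_comb P w v = (\<Sum>p\<in>P. fscale (w p) (perm_act p v))"

lemma linear_perm_comb: "fun_linear (perm_comb P w)"
  unfolding perm_comb_def by (rule fun_linear_comb) (rule linear_perm_act)

text \<open>
  In the group algebra: if \<open>P\<close> is stable under right multiplication by \<open>q\<close> and the weights satisfy
  \<open>w (p q) = \<epsilon> w p\<close>, then \<open>\<Sum>p. w p * p\<close> equals \<open>\<epsilon>\<close> times its product with \<open>q\<close>.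
\<close>

lemma perm_comb_absorb:
  assumes P: "bij_betw (\<lambda>p. p \<circ> q) P P" "\<And>p. p \<in> P \<Longrightarrow> bij p" and q: "bij q"
    and w: "\<And>p. p \<in> P \<Longrightarrow> w (p \<circ> q) = \<epsilon> * w p"
  shows "perm_comb P w v = fscale \<epsilon> (perm_comb P w (perm_act q v))"
proof -
  have "perm_comb P w v = (\<Sum>p\<in>P. fscale (w (p \<circ> q)) (perm_act (p \<circ> q) v))"
    unfolding perm_comb_def
    by (rule sum.reindex_bij_betw[OF P(1), of "\<lambda>p. fscale (w p) (perm_act p v)", symmetric])
  also have "\<dots> = (\<Sum>p\<in>P. fscale \<epsilon> (fscale (w p) (perm_act p (perm_act q v))))"
    by (intro sum.cong refl) (simp add: w perm_act_comp P(2) q)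
  finally show ?thesis by (simp add: perm_comb_def fun_vs.scale_sum_right)
qed

text \<open>
  A symmetrizer annihilates every vector on which one of its elements acts with the opposite sign:
  absorbing \<open>q\<close> shows that the image equals its own negative.
\<close>

lemma perm_comb_set_stabilizer_eq_0:
  fixes v :: "tabloid \<Rightarrow> 'k::field_char_0"
  assumes q: "q \<in> set_stabilizer n F"
    and w: "\<And>p. p \<in> set_stabilizer n F \<Longrightarrow> w (p \<circ> q) = \<epsilon> * w p"
    and v: "perm_act q v = fscale \<delta> v" and "\<epsilon> * \<delta> = - 1"
  shows "perm_comb (set_stabilizer n F) w v = 0"
proof -
  interpret L: Vector_Spaces.linear fscale fscale "perm_comb (set_stabilizer n F) w"
    by (rule linear_perm_comb)
  have "perm_comb (set_stabilizer n F) w v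
      = fscale \<epsilon> (perm_comb (set_stabilizer n F) w (perm_act q v))"
    using q w
    by (intro perm_comb_absorb bij_betw_set_stabilizer_comp)
      (auto dest: set_stabilizer_permutes permutes_bij)
  also have "\<dots> = fscale (- 1) (perm_comb (set_stabilizer n F) w v)"
    using assms(4) by (simp only: v L.scale fun_vs.scale_scale)
  finally show ?thesis by (auto simp: fscale_def fun_eq_iff eq_neg_iff_add_eq_0)
qed

abbreviation sgn_weight :: "(nat \<Rightarrow> nat) \<Rightarrow> 'k::field" where
  "sgn_weight p \<equiv> of_int (sign p)"

lemma sgn_weight_comp:
  assumes "p permutes {1..n}" "q permutes {1..n}"
  shows "sgn_weight (p \<circ> q) = (sgn_weight q * sgn_weight p :: 'k::field)"
proof -
  have "permutation p" "permutation q" using assms by (auto simp: permutation_permutes)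
  then show ?thesis by (simp add: sign_compose)
qed

lemma sgn_weight_square: "sgn_weight p * sgn_weight p = (1 :: 'k::field)"
  by (simp add: sign_def)

definition tabloid_space :: "nat list \<Rightarrow> (tabloid \<Rightarrow> 'k::field) set" where
  "tabloid_space lam = fun_vs.span (tabloid_vec lam ` tableaux lam)"

lemma polytabloid_in_tabloid_space:
  assumes "t \<in> tableaux lam"
  shows "polytabloid lam t \<in> tabloid_space lam"
  unfolding polytabloid_def tabloid_space_def
proof (intro fun_vs.span_sum fun_vs.span_scale fun_vs.span_base imageI)
  fix p assume "p \<in> column_stabilizer lam t"
  then have "p permutes {1..sum_list lam}"
    unfolding column_stabilizer_eq by (rule set_stabilizer_permutes)
  then show "p \<circ> t \<in> tableaux lam" using assms by (rule tableaux_comp)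
qed

lemma specht_module_subset: "specht_module lam \<subseteq> tabloid_space lam"
  unfolding specht_module_def
  by (rule fun_vs.span_minimal)
    (auto simp: polytabloid_in_tabloid_space, simp add: tabloid_space_def)

lemma polytabloid_in: "t \<in> tableaux lam \<Longrightarrow> polytabloid lam t \<in> specht_module lam"
  unfolding specht_module_def by (intro fun_vs.span_base imageI)

lemma polytabloid_eq_perm_comb:
  "polytabloid lam t = perm_comb (column_stabilizer lam t) sgn_weight (tabloid_vec lam t)"
  unfolding polytabloid_def perm_comb_def
proof (intro sum.cong refl)
  fix p assume "p \<in> column_stabilizer lam t"
  then have "p permutes {1..sum_list lam}"
    unfolding column_stabilizer_eq by (rule set_stabilizer_permutes)
  then show "fscale (sgn_weight p) (tabloid_vec lam (p \<circ> t)) =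
      fscale (sgn_weight p) (perm_act p (tabloid_vec lam t))"
    by (simp only: perm_act_tabloid_vec)
qed

text \<open>
  A column permutation that preserves the tabloid of \<open>t\<close> fixes the row and the column of every
  entry, hence is the identity. So the tabloid of \<open>t\<close> occurs exactly once in the polytabloid.
\<close>

lemma polytabloid_at_own_tabloid:
  assumes t: "t \<in> tableaux lam"
  shows "polytabloid lam t (tabloid_of lam t) = (1 :: 'k::field)"
proof -
  let ?C = "column_stabilizer lam t"
  have id: "p = id" if p: "p \<in> ?C" "tabloid_of lam t = tabloid_of lam (p \<circ> t)" for p
  proof
    have perm: "p permutes {1..sum_list lam}"
      using p(1) unfolding column_stabilizer_eq by (rule set_stabilizer_permutes)
    have pt: "p \<circ> t \<in> tableaux lam" using perm t by (rule tableaux_comp)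
    fix x
    show "p x = id x"
    proof (cases "x \<in> {1..sum_list lam}")
      case True
      then have px: "p x \<in> {1..sum_list lam}" using permutes_in_image[OF perm] by blast
      have "p x \<in> p ` col_entries lam t (snd (box_of lam t x))"
        using True by (simp add: col_entries_box[OF t])
      also have "\<dots> = col_entries lam t (snd (box_of lam t x))"
        using p(1) by (simp add: column_stabilizer_def)
      finally have "snd (box_of lam t (p x)) = snd (box_of lam t x)"
        by (simp add: col_entries_box[OF t])
      moreover have "fst (box_of lam t (p x)) = fst (box_of lam (p \<circ> t) (p x))"
        using p(2)[unfolded tabloid_of_eq_iff[OF t pt]] px by blast
      then have "fst (box_of lam t (p x)) = fst (box_of lam t x)"
        by (simp only: box_of_comp[OF perm t True])
      ultimately have "box_of lam t (p x) = box_of lam t x" by (simp add: prod_eq_iff)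
      then show ?thesis using tableau_box_of[OF t True] tableau_box_of[OF t px] by simp
    next
      case False
      then show ?thesis using perm by (simp add: permutes_def)
    qed
  qed
  have "polytabloid lam t (tabloid_of lam t)
      = (\<Sum>p\<in>?C. sgn_weight p * (if tabloid_of lam t = tabloid_of lam (p \<circ> t) then 1 else (0::'k)))"
    by (simp add: polytabloid_def sum_fun_apply fscale_def tabloid_vec_def)
  also have "\<dots> = (\<Sum>p\<in>?C. if p = id then 1 else 0)"
    by (intro sum.cong refl) (use id in auto)
  also have "\<dots> = 1"
    using finite_set_stabilizer id_set_stabilizer by (simp add: column_stabilizer_eq)
  finally show ?thesis .
qed

lemma polytabloid_nonzero: "t \<in> tableaux lam \<Longrightarrow> polytabloid lam t \<noteq> (0 :: tabloid \<Rightarrow> 'k::field)"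
  using polytabloid_at_own_tabloid[of t lam, where 'k = 'k] by auto

lemma perm_act_tabloid_vec_transpose:
  assumes s: "s \<in> tableaux lam" and xy: "x \<in> {1..sum_list lam}" "y \<in> {1..sum_list lam}"
    and row: "fst (box_of lam s x) = fst (box_of lam s y)"
  shows "perm_act (transpose x y) (tabloid_vec lam s) = (tabloid_vec lam s :: tabloid \<Rightarrow> 'k::field)"
proof -
  let ?q = "transpose x y"
  have q: "?q permutes {1..sum_list lam}" using xy by (rule permutes_swap_id)
  have "tabloid_of lam (?q \<circ> s) = tabloid_of lam s"
    unfolding tabloid_of_eq_iff[OF tableaux_comp[OF q s] s]
  proof
    fix z assume z: "z \<in> {1..sum_list lam}"
    have qz: "?q z \<in> {1..sum_list lam}" using z permutes_in_image[OF q] by blast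
    have "box_of lam (?q \<circ> s) z = box_of lam s (?q z)"
      using box_of_comp[OF q s qz] by simp
    then show "fst (box_of lam (?q \<circ> s) z) = fst (box_of lam s z)"
      using row by (simp add: transpose_def)
  qed
  then show ?thesis by (simp add: perm_act_tabloid_vec[OF q]) (simp add: tabloid_vec_def)
qed

text \<open>
  The signed column sum \<open>\<kappa>\<close> of \<open>t\<close> maps the whole permutation module to the line through the
  polytabloid of \<open>t\<close>. For a tabloid that shares a row with two entries of one column of \<open>t\<close>, their
  transposition kills the image; any other tabloid is a column permutation of that of \<open>t\<close> by
  \<open>column_stabilizer_straighten\<close>, and \<open>\<kappa>\<close> absorbs this permutation up to its sign.
\<close>

lemma column_antisymmetrizer_line:
  fixes v :: "tabloid \<Rightarrow> 'k::field_char_0"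
  assumes lam: "sorted_wrt (\<ge>) lam" and t: "t \<in> tableaux lam" and v: "v \<in> tabloid_space lam"
  shows "\<exists>a. perm_comb (column_stabilizer lam t) sgn_weight v = fscale a (polytabloid lam t)"
proof -
  let ?C = "column_stabilizer lam t"
  let ?k = "perm_comb ?C sgn_weight :: (tabloid \<Rightarrow> 'k) \<Rightarrow> tabloid \<Rightarrow> 'k"
  interpret L: Vector_Spaces.linear fscale fscale ?k by (rule linear_perm_comb)
  have Cp: "p permutes {1..sum_list lam}" if "p \<in> ?C" for p
    using that unfolding column_stabilizer_eq by (rule set_stabilizer_permutes)
  have base: "\<exists>a. ?k (tabloid_vec lam s) = fscale a (polytabloid lam t)" if s: "s \<in> tableaux lam" for s
  proof (cases "inj_on (\<lambda>x. (fst (box_of lam s x), snd (box_of lam t x))) {1..sum_list lam}")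
    case True
    obtain p where p: "p \<in> ?C" "tabloid_of lam (p \<circ> t) = tabloid_of lam s"
      using column_stabilizer_straighten[OF lam t s True] by blast
    have "polytabloid lam t = ?k (tabloid_vec lam t)" by (rule polytabloid_eq_perm_comb)
    also have "\<dots> = fscale (sgn_weight p) (?k (perm_act p (tabloid_vec lam t)))"
      using p(1) Cp
      by (intro perm_comb_absorb)
        (use Cp sgn_weight_comp[OF Cp Cp] in \<open>auto simp: column_stabilizer_eq
            intro!: bij_betw_set_stabilizer_comp permutes_bij\<close>)
    also have "perm_act p (tabloid_vec lam t) = (tabloid_vec lam s :: tabloid \<Rightarrow> 'k)"
      by (simp add: perm_act_tabloid_vec[OF Cp[OF p(1)]]) (simp add: tabloid_vec_def p(2))
    finally have "fscale (sgn_weight p) (polytabloid lam t) = ?k (tabloid_vec lam s)"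
      by (simp add: sgn_weight_square)
    then show ?thesis by metis
  next
    case False
    then obtain x y where xy: "x \<in> {1..sum_list lam}" "y \<in> {1..sum_list lam}" "x \<noteq> y"
      "fst (box_of lam s x) = fst (box_of lam s y)" "snd (box_of lam t x) = snd (box_of lam t y)"
      by (auto simp: inj_on_def)
    have "?k (tabloid_vec lam s) = 0"
      unfolding column_stabilizer_eq
    proof (rule perm_comb_set_stabilizer_eq_0[where \<epsilon> = "- 1" and \<delta> = 1])
      show q: "transpose x y \<in> set_stabilizer (sum_list lam) (col_entries lam t)"
        using xy by (intro transpose_set_stabilizer) (auto simp: col_entries_box[OF t])
      show "sgn_weight (p \<circ> transpose x y) = (- 1 * sgn_weight p :: 'k)"
        if "p \<in> set_stabilizer (sum_list lam) (col_entries lam t)" for p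
        using sgn_weight_comp[OF set_stabilizer_permutes[OF that] set_stabilizer_permutes[OF q]] xy(3)
        by (simp add: sign_swap_id)
      show "perm_act (transpose x y) (tabloid_vec lam s) = fscale 1 (tabloid_vec lam s :: tabloid \<Rightarrow> 'k)"
        using perm_act_tabloid_vec_transpose[OF s xy(1,2,4)] by simp
    qed simp
    then show ?thesis by (intro exI[of _ 0]) simp
  qed
  have "fun_vs.subspace {v. \<exists>a. ?k v = fscale a (polytabloid lam t)}"
  proof (rule fun_vs.subspaceI; unfold mem_Collect_eq)
    show "\<exists>a. ?k 0 = fscale a (polytabloid lam t)" by (intro exI[of _ 0]) (simp add: L.zero)
    show "\<exists>a. ?k (u + v) = fscale a (polytabloid lam t)"
      if "\<exists>a. ?k u = fscale a (polytabloid lam t)" "\<exists>a. ?k v = fscale a (polytabloid lam t)" for u v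
      using that by (metis L.add fun_vs.scale_left_distrib)
    show "\<exists>a. ?k (fscale c v) = fscale a (polytabloid lam t)"
      if "\<exists>a. ?k v = fscale a (polytabloid lam t)" for c v
      using that by (metis L.scale fun_vs.scale_scale)
  qed
  then have "tabloid_space lam \<subseteq> {v. \<exists>a. ?k v = fscale a (polytabloid lam t)}"
    unfolding tabloid_space_def by (rule fun_vs.span_minimal[rotated]) (use base in auto)
  then show ?thesis using v by blast
qed


section \<open>Central elements act on a Specht module as scalars\<close>

lemma fin_dim_specht_module: "fin_dim (specht_module lam)"
  unfolding fin_dim_def by (rule specht_module_basis)

lemma trace_perm_sum:
  assumes "\<And>i. i \<in> I \<Longrightarrow> s i permutes {1..sum_list lam}"
  shows "trace_on (specht_module lam) (\<lambda>v. \<Sum>i\<in>I. fscale (w i) (perm_act (s i) v))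
    = (\<Sum>i\<in>I. w i * (specht_character lam (s i) :: 'k::field_char_0))"
  unfolding specht_character_def
  by (rule trace_on_comb[OF fin_dim_specht_module]) (auto simp: linear_perm_act dest: perm_act_specht_module assms)

lemma perm_comb_specht_module:
  assumes "\<And>p. p \<in> P \<Longrightarrow> p permutes {1..sum_list lam}"
    and "v \<in> specht_module lam"
  shows "perm_comb P w v \<in> specht_module lam"
proof -
  have "perm_act p v \<in> fun_vs.span (polytabloid lam ` tableaux lam)" if "p \<in> P" for p
    using perm_act_specht_module[OF assms(1)[OF that]] assms(2) unfolding specht_module_def by blast
  then show ?thesis
    unfolding perm_comb_def specht_module_def by (intro fun_vs.span_sum fun_vs.span_scale)
qed

text \<open>
  Specht characters are class functions, because \<open>tr (f g) = tr (g f)\<close>.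
\<close>

lemma specht_character_conj:
  assumes p: "p permutes {1..sum_list lam}" and q: "q permutes {1..sum_list lam}"
  shows "specht_character lam (q \<circ> p \<circ> inv' q) = (specht_character lam p :: 'k::field_char_0)"
proof -
  let ?V = "specht_module lam :: (tabloid \<Rightarrow> 'k) set"
  have iq: "inv' q permutes {1..sum_list lam}" using q by (rule permutes_inv)
  have qp: "q \<circ> p permutes {1..sum_list lam}" using p q by (rule permutes_compose)
  note b = permutes_bij[OF p] permutes_bij[OF q] permutes_bij[OF iq] permutes_bij[OF qp]
  have "specht_character lam (q \<circ> p \<circ> inv' q) = trace_on ?V (perm_act (q \<circ> p) \<circ> perm_act (inv' q))"
    unfolding specht_character_def
    by (rule arg_cong[of _ _ "trace_on ?V"]) (simp add: fun_eq_iff[of "perm_act _"] perm_act_comp b)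
  also have "\<dots> = trace_on ?V (perm_act (inv' q) \<circ> perm_act (q \<circ> p))"
    by (intro trace_on_comp_commute fin_dim_specht_module linear_perm_act perm_act_specht_module qp iq)
  also have "\<dots> = specht_character lam p"
    unfolding specht_character_def
    by (rule arg_cong[of _ _ "trace_on ?V"])
      (simp add: fun_eq_iff[of _ "perm_act _"] perm_act_comp b o_assoc permutes_inv_o[OF q])
  finally show ?thesis .
qed

text \<open>
  The action of \<open>\<Sum>g. g a g\<inverse>\<close>, a positive multiple of the sum over the conjugacy class of \<open>a\<close>.
\<close>

definition conj_sum :: "nat \<Rightarrow> (nat \<Rightarrow> nat) \<Rightarrow> (tabloid \<Rightarrow> 'k::field) \<Rightarrow> tabloid \<Rightarrow> 'k" where
  "conj_sum n a v = (\<Sum>g | g permutes {1..n}. perm_act (g \<circ> a \<circ> inv' g) v)"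

lemma conj_permutes: "g permutes S \<Longrightarrow> a permutes S \<Longrightarrow> g \<circ> a \<circ> inv' g permutes S"
  by (intro permutes_compose permutes_inv)

lemma linear_conj_sum: "fun_linear (conj_sum n a :: (tabloid \<Rightarrow> 'k::field) \<Rightarrow> _)"
proof -
  have "fun_linear (\<lambda>v :: tabloid \<Rightarrow> 'k. \<Sum>g | g permutes {1..n}. fscale 1 (perm_act (g \<circ> a \<circ> inv' g) v))"
    by (rule fun_linear_comb) (rule linear_perm_act)
  then show ?thesis by (simp add: conj_sum_def[abs_def])
qed

lemma conj_sum_perm_act:
  assumes a: "a permutes {1..n}" and h: "h permutes {1..n}"
  shows "conj_sum n a (perm_act h v) = perm_act h (conj_sum n a v :: tabloid \<Rightarrow> 'k::field)"
proof -
  interpret L: Vector_Spaces.linear fscale fscale "perm_act h :: (tabloid \<Rightarrow> 'k) \<Rightarrow> _"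
    by (rule linear_perm_act)
  let ?G = "{g. g permutes {1..n}}"
  have bij: "bij_betw (\<lambda>g. h \<circ> g) ?G ?G"
    by (rule bij_betw_byWitness[where f' = "\<lambda>g. inv' h \<circ> g"])
      (auto simp: o_assoc permutes_inv_o[OF h] intro: permutes_compose permutes_inv h)
  have "conj_sum n a (perm_act h v) = (\<Sum>g\<in>?G. perm_act (g \<circ> a \<circ> inv' g \<circ> h) v)"
    unfolding conj_sum_def
    by (intro sum.cong refl perm_act_comp) (use a h in \<open>auto intro: permutes_bij conj_permutes\<close>)
  also have "\<dots> = (\<Sum>g\<in>?G. perm_act ((h \<circ> g) \<circ> a \<circ> inv' (h \<circ> g) \<circ> h) v)"
    by (rule sum.reindex_bij_betw[OF bij, symmetric])
  also have "\<dots> = (\<Sum>g\<in>?G. perm_act h (perm_act (g \<circ> a \<circ> inv' g) v))"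
  proof (intro sum.cong refl)
    fix g assume "g \<in> ?G"
    then have g: "g permutes {1..n}" by simp
    have "(h \<circ> g) \<circ> a \<circ> inv' (h \<circ> g) \<circ> h = h \<circ> (g \<circ> a \<circ> inv' g)"
      by (simp add: fun_eq_iff o_inv_distrib[OF permutes_bij[OF h] permutes_bij[OF g]]
          permutes_inverses[OF h])
    then show "perm_act ((h \<circ> g) \<circ> a \<circ> inv' (h \<circ> g) \<circ> h) v = perm_act h (perm_act (g \<circ> a \<circ> inv' g) v)"
      by (simp add: perm_act_comp permutes_bij[OF h] permutes_bij[OF conj_permutes[OF g a]])
  qed
  finally show ?thesis by (simp add: conj_sum_def L.sum)
qed

text \<open>
  A central element \<open>z\<close> commutes with the signed column sum \<open>\<kappa>\<close> of a tableau \<open>t\<close>, so it maps the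
  polytabloid \<open>\<kappa> {t}\<close> to \<open>\<kappa> (z {t})\<close>, which lies on the line through this polytabloid. The scalar is
  the same for all tableaux since they are permuted transitively and \<open>z\<close> commutes with the group.
  This replaces Schur's lemma and the irreducibility of the Specht module.
\<close>

lemma conj_sum_scalar:
  assumes lam: "sorted_wrt (\<ge>) lam" and a: "a permutes {1..sum_list lam}"
  shows "\<exists>c. \<forall>v\<in>specht_module lam. conj_sum (sum_list lam) a v = fscale c (v :: tabloid \<Rightarrow> 'k::field_char_0)"
proof -
  let ?z = "conj_sum (sum_list lam) a :: (tabloid \<Rightarrow> 'k) \<Rightarrow> _"
  interpret L: Vector_Spaces.linear fscale fscale ?z by (rule linear_conj_sum)
  obtain t where t: "t \<in> tableaux lam" using exists_tableau by blast
  have "?z (polytabloid lam t) = perm_comb (column_stabilizer lam t) sgn_weight (?z (tabloid_vec lam t))"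
    unfolding polytabloid_eq_perm_comb perm_comb_def L.sum L.scale
    by (intro sum.cong refl)
      (simp add: conj_sum_perm_act a column_stabilizer_eq set_stabilizer_permutes)
  moreover have "?z (tabloid_vec lam t) \<in> tabloid_space lam"
    unfolding conj_sum_def tabloid_space_def
  proof (intro fun_vs.span_sum fun_vs.span_base)
    fix g assume "g \<in> {g. g permutes {1..sum_list lam}}"
    then have g: "g \<circ> a \<circ> inv' g permutes {1..sum_list lam}" using a by (simp add: conj_permutes)
    show "perm_act (g \<circ> a \<circ> inv' g) (tabloid_vec lam t) \<in> tabloid_vec lam ` tableaux lam"
      unfolding perm_act_tabloid_vec[OF g] by (intro imageI tableaux_comp g t)
  qed
  ultimately obtain c where c: "?z (polytabloid lam t) = fscale c (polytabloid lam t)"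
    using column_antisymmetrizer_line[OF lam t] by metis
  have "specht_module lam \<subseteq> {v. ?z v = fscale c v}"
    unfolding specht_module_def
  proof (rule fun_vs.span_minimal)
    show "fun_vs.subspace {v. ?z v = fscale c v}"
      by (auto simp: fun_vs.subspace_def L.add L.scale fun_vs.scale_right_distrib mult.commute)
    show "polytabloid lam ` tableaux lam \<subseteq> {v. ?z v = fscale c v}"
    proof (clarsimp)
      fix s assume s: "s \<in> tableaux lam"
      obtain h where h: "h permutes {1..sum_list lam}" "s = h \<circ> t"
        using tableaux_transitive[OF s t] by blast
      interpret H: Vector_Spaces.linear fscale fscale "perm_act h :: (tabloid \<Rightarrow> 'k) \<Rightarrow> _"
        by (rule linear_perm_act)
      show "?z (polytabloid lam s) = fscale c (polytabloid lam s)"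
        unfolding h(2) perm_act_polytabloid[OF h(1), symmetric] conj_sum_perm_act[OF a h(1)] c H.scale ..
    qed
  qed
  then show ?thesis by blast
qed

text \<open>
  If the character \<open>\<chi>\<close> vanishes at \<open>a\<close>, the scalar by which \<open>\<Sum>g. g a g\<inverse>\<close> acts has trace
  \<open>n! * \<chi> a = 0\<close>, so it is zero, and composing with \<open>b\<close> still gives an operator of trace zero. It is
  the case \<open>\<chi> a = 0\<close> of \<open>\<Sum>g. \<chi> (g a g\<inverse> b) = n! * \<chi> a * \<chi> b / \<chi> 1\<close>.
\<close>

lemma character_sum_conjugates_eq_0:
  assumes lam: "sorted_wrt (\<ge>) lam"
    and a: "a permutes {1..sum_list lam}" and b: "b permutes {1..sum_list lam}"
    and 0: "specht_character lam a = (0 :: 'k::field_char_0)"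
  shows "(\<Sum>g | g permutes {1..sum_list lam}. specht_character lam (g \<circ> a \<circ> inv' g \<circ> b)) = (0 :: 'k)"
proof -
  let ?n = "sum_list lam" and ?V = "specht_module lam :: (tabloid \<Rightarrow> 'k) set"
  let ?G = "{g. g permutes {1..sum_list lam}}"
  obtain c where c: "conj_sum ?n a v = fscale c v" if "v \<in> ?V" for v
    using conj_sum_scalar[OF lam a, where 'k = 'k] by blast
  obtain t where t: "t \<in> tableaux lam" using exists_tableau by blast
  have "trace_on ?V (conj_sum ?n a) = (\<Sum>g\<in>?G. 1 * (specht_character lam (g \<circ> a \<circ> inv' g) :: 'k))"
    using trace_perm_sum[of ?G "\<lambda>g. g \<circ> a \<circ> inv' g" lam "\<lambda>_. 1 :: 'k"] conj_permutes[OF _ a]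
    by (simp add: conj_sum_def[abs_def])
  also have "\<dots> = 0" by (simp add: specht_character_conj[OF a] 0)
  finally have "c = 0"
    by (intro trace_on_scalar_eq_0[OF fin_dim_specht_module linear_conj_sum c
          polytabloid_in[OF t] polytabloid_nonzero[OF t]])
  then have z: "conj_sum ?n a v = 0" if "v \<in> ?V" for v using c[OF that] by simp
  have bV: "perm_act b v \<in> ?V" if "v \<in> ?V" for v using perm_act_specht_module[OF b] that by blast
  have "(\<lambda>v :: tabloid \<Rightarrow> 'k. \<Sum>g\<in>?G. fscale 1 (perm_act (g \<circ> a \<circ> inv' g \<circ> b) v))
      = (\<lambda>v. conj_sum ?n a (perm_act b v))"
    unfolding conj_sum_def fun_vs.scale_one
  proof (rule ext, intro sum.cong refl)
    fix v g assume "g \<in> ?G"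
    then have "bij (g \<circ> a \<circ> inv' g)" using permutes_bij[OF conj_permutes[OF _ a]] by blast
    then show "perm_act (g \<circ> a \<circ> inv' g \<circ> b) v = (perm_act (g \<circ> a \<circ> inv' g) (perm_act b v) :: tabloid \<Rightarrow> 'k)"
      by (simp only: perm_act_comp permutes_bij[OF b])
  qed
  moreover have "trace_on ?V (\<lambda>v. \<Sum>g\<in>?G. fscale 1 (perm_act (g \<circ> a \<circ> inv' g \<circ> b) v))
      = (\<Sum>g\<in>?G. 1 * specht_character lam (g \<circ> a \<circ> inv' g \<circ> b))"
    by (rule trace_perm_sum) (use a b in \<open>auto intro: permutes_compose conj_permutes\<close>)
  moreover have "trace_on ?V (\<lambda>v. conj_sum ?n a (perm_act b v)) = 0"
    using trace_on_nonzeroD[OF fin_dim_specht_module, of "\<lambda>v. conj_sum ?n a (perm_act b v)"]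
      Vector_Spaces.linear_compose[OF linear_perm_act linear_conj_sum] z bV
    by (fastforce simp: o_def)
  ultimately show ?thesis by simp
qed


section \<open>Permutations and the points they move\<close>

lemma extend_to_permutation:
  assumes S: "finite S" and A: "A \<subseteq> S" and \<phi>: "inj_on \<phi> A" "\<phi> ` A \<subseteq> S"
  obtains h where "h permutes S" "\<And>x. x \<in> A \<Longrightarrow> h x = \<phi> x"
proof -
  have "card (S - A) = card (S - \<phi> ` A)"
    using assms finite_subset[OF A S] by (simp add: card_Diff_subset card_image)
  then obtain f where f: "bij_betw f (S - A) (S - \<phi> ` A)"
    using S finite_same_card_bij[of "S - A" "S - \<phi> ` A"] by blast
  define h where "h x = (if x \<in> A then \<phi> x else if x \<in> S then f x else x)" for x
  have "bij_betw h A (\<phi> ` A)" using \<phi>(1) by (simp add: bij_betw_def h_def inj_on_def)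
  moreover have "bij_betw h (S - A) (S - \<phi> ` A)"
    using f by (rule bij_betw_cong[THEN iffD1, rotated]) (simp add: h_def)
  ultimately have "bij_betw h (A \<union> (S - A)) (\<phi> ` A \<union> (S - \<phi> ` A))"
    by (rule bij_betw_combine) auto
  moreover have "A \<union> (S - A) = S" "\<phi> ` A \<union> (S - \<phi> ` A) = S" using A \<phi>(2) by auto
  ultimately have "bij_betw h S S" by simp
  then have "h permutes S" by (rule bij_imp_permutes) (use A in \<open>auto simp: h_def\<close>)
  then show ?thesis by (rule that) (simp add: h_def)
qed

lemma list_to_list_permutation:
  assumes S: "finite S" and xs: "distinct xs" "set xs \<subseteq> S" and ys: "distinct ys" "set ys \<subseteq> S"
    and len: "length xs = length ys"
  obtains h where "h permutes S" "map h xs = ys"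
proof -
  define \<phi> where "\<phi> x = the (map_of (zip xs ys) x)" for x
  have nth: "\<phi> (xs ! i) = ys ! i" if "i < length xs" for i
    using that len xs(1) by (simp add: \<phi>_def map_of_zip_nth)
  have m: "map \<phi> xs = ys" using nth len by (intro nth_equalityI) auto
  then have "inj_on \<phi> (set xs)" using ys(1) xs(1) by (auto simp: distinct_map)
  moreover have "\<phi> ` set xs \<subseteq> S" using m ys(2) by auto
  ultimately obtain h where "h permutes S" "\<And>x. x \<in> set xs \<Longrightarrow> h x = \<phi> x"
    using extend_to_permutation[OF S xs(2)] by blast
  moreover from this(2) have "map h xs = map \<phi> xs" by simp
  ultimately show ?thesis using that m by metis
qed

lemma sign_cycle_of_list: "cycle cs \<Longrightarrow> sign (cycle_of_list cs) = (- 1) ^ (length cs - 1)"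
proof (induction cs rule: cycle_of_list.induct)
  case (1 i j cs)
  then have "i \<noteq> j" by auto
  moreover have "sign (cycle_of_list (i # j # cs)) = sign (transpose i j) * sign (cycle_of_list (j # cs))"
    unfolding cycle_of_list.simps(1)
    by (rule sign_compose[OF permutation_swap_id permutation_of_cycle])
  ultimately show ?case using 1 by (simp add: sign_swap_id del: cycle_of_list.simps)
qed (simp_all)

text \<open>
  A rotation of \<open>cs\<close> arises by applying a power of its own cycle, which commutes with that cycle.
\<close>

lemma cycle_of_list_starting_at:
  assumes cs: "cycle cs" and u: "u \<in> set cs"
  obtains cs' where "cycle (u # cs')" "set (u # cs') = set cs" "length (u # cs') = length cs"
    "cycle_of_list (u # cs') = cycle_of_list cs"
proof -
  let ?c = "cycle_of_list cs"
  obtain m where m: "m < length cs" "cs ! m = u" using u by (auto simp: in_set_conv_nth)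
  define ds where "ds = rotate m cs"
  have hd: "ds = u # tl ds"
  proof -
    have "cs \<noteq> []" using m(1) by auto
    then have "hd ds = u" "ds \<noteq> []" using m hd_rotate_conv_nth[of cs m] by (simp_all add: ds_def)
    then show ?thesis by (metis list.collapse)
  qed
  have bm: "bij (?c ^^ m)" using permutation_bijective[OF permutation_funpow[OF permutation_of_cycle]] .
  have "cycle_of_list ds = (?c ^^ m) \<circ> ?c \<circ> inv' (?c ^^ m)"
    using conjugation_of_cycle[OF cs bm] cyclic_rotation[OF cs, of m] by (simp add: ds_def)
  also have "\<dots> = ?c \<circ> ((?c ^^ m) \<circ> inv' (?c ^^ m))"
    by (metis comp_assoc funpow_Suc_right funpow.simps(2))
  also have "\<dots> = ?c" using bij_is_surj[OF bm] by (simp add: surj_iff)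
  finally have "cycle_of_list ds = ?c" .
  moreover have "cycle ds" "set ds = set cs" "length ds = length cs" using cs by (simp_all add: ds_def)
  ultimately show ?thesis using that[of "tl ds"] hd by metis
qed

abbreviation moved :: "(nat \<Rightarrow> nat) \<Rightarrow> nat set" where
  "moved p \<equiv> {x. p x \<noteq> x}"

lemma moved_subset: "p permutes S \<Longrightarrow> moved p \<subseteq> S"
  by (auto simp: permutes_def)

lemma moved_image: "p permutes S \<Longrightarrow> x \<in> moved p \<Longrightarrow> p x \<in> moved p"
  using permutes_inj[of p S] by (auto simp: inj_eq)

lemma moved_comp_subset: "moved (p \<circ> q) \<subseteq> moved p \<union> moved q"
  by auto

lemma moved_conj:
  assumes "g permutes S"
  shows "moved (g \<circ> a \<circ> inv' g) = g ` moved a"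
proof (intro equalityI subsetI)
  fix x assume "x \<in> moved (g \<circ> a \<circ> inv' g)"
  then have "inv' g x \<in> moved a" using permutes_inverses(1)[OF assms, of x] by auto
  then show "x \<in> g ` moved a" using permutes_inverses(1)[OF assms, of x] by (metis image_eqI)
next
  fix x assume "x \<in> g ` moved a"
  then show "x \<in> moved (g \<circ> a \<circ> inv' g)"
    using permutes_inverses(2)[OF assms] by (auto simp: inj_eq[OF permutes_inj[OF assms]])
qed

lemma disjoint_comp_commute:
  assumes "a permutes S" "b permutes S" "moved a \<inter> moved b = {}"
  shows "a \<circ> b = b \<circ> a"
proof
  have dis: "a x = x \<or> b x = x" for x using assms(3) by blast
  fix x
  consider "x \<in> moved a" | "x \<in> moved b" | "a x = x" "b x = x" by blast
  then show "(a \<circ> b) x = (b \<circ> a) x"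
  proof cases
    case 1
    then show ?thesis using moved_image[OF assms(1) 1] dis[of x] dis[of "a x"] by simp
  next
    case 2
    then show ?thesis using moved_image[OF assms(2) 2] dis[of x] dis[of "b x"] by simp
  qed simp
qed

lemma moved_disjoint_comp:
  assumes "a permutes S" "b permutes S" "moved a \<inter> moved b = {}"
  shows "moved (a \<circ> b) = moved a \<union> moved b"
proof -
  have dis: "a x = x \<or> b x = x" for x using assms(3) by blast
  have "x \<in> moved (a \<circ> b)" if "x \<in> moved a" for x using that dis[of x] by simp
  moreover have "x \<in> moved (a \<circ> b)" if "x \<in> moved b" for x
  proof -
    have "x \<in> moved (b \<circ> a)" using that dis[of x] by simp
    then show ?thesis by (simp only: disjoint_comp_commute[OF assms])
  qed
  ultimately show ?thesis by auto
qed

lemma moved_empty_iff: "moved p = {} \<longleftrightarrow> p = id"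
  by (auto simp: fun_eq_iff)

text \<open>
  The conjugating permutation agrees with \<open>g\<close> on the points moved by \<open>a\<close> and with the identity on
  those moved by \<open>b\<close>; this is injective because the images stay disjoint.
\<close>

lemma disjoint_product_conj:
  assumes S: "finite S" and a: "a permutes S" and b: "b permutes S" and g: "g permutes S"
    and ab: "moved a \<inter> moved b = {}" and gab: "g ` moved a \<inter> moved b = {}"
  obtains h where "h permutes S" "h \<circ> (a \<circ> b) \<circ> inv' h = g \<circ> a \<circ> inv' g \<circ> b"
proof -
  let ?A = "moved a" and ?B = "moved b"
  define \<phi> where "\<phi> x = (if x \<in> ?A then g x else x)" for x
  have AS: "?A \<subseteq> S" "?B \<subseteq> S" using moved_subset a b by blast+
  have gi: "g x = g y \<longleftrightarrow> x = y" for x y using permutes_inj[OF g] by (auto dest: injD)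
  have inj: "inj_on \<phi> (?A \<union> ?B)"
  proof (rule inj_onI)
    fix x y assume xy: "x \<in> ?A \<union> ?B" "y \<in> ?A \<union> ?B" "\<phi> x = \<phi> y"
    have ne: "g u \<noteq> v" if "u \<in> ?A" "v \<in> ?B" for u v using that gab by blast
    consider "x \<in> ?A" "y \<in> ?A" | "x \<in> ?A" "y \<notin> ?A" | "x \<notin> ?A" "y \<in> ?A" | "x \<notin> ?A" "y \<notin> ?A"
      by blast
    then show "x = y"
    proof cases
      case 1
      then show ?thesis using xy(3) by (simp only: \<phi>_def if_True gi)
    next
      case 2
      then have "g x = y" using xy(3) by (simp only: \<phi>_def if_True if_False)
      then show ?thesis using ne[of x y] 2 xy(2) by blast
    next
      case 3
      then have "g y = x" using xy(3) by (simp only: \<phi>_def if_True if_False)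
      then show ?thesis using ne[of y x] 3 xy(1) by blast
    next
      case 4
      then show ?thesis using xy(3) by (simp only: \<phi>_def if_False)
    qed
  qed
  have "\<phi> ` (?A \<union> ?B) \<subseteq> S" using AS permutes_in_image[OF g] by (auto simp: \<phi>_def)
  then obtain h where h: "h permutes S" "\<And>x. x \<in> ?A \<union> ?B \<Longrightarrow> h x = \<phi> x"
    using extend_to_permutation[OF S _ inj] AS by blast
  have hA: "h x = g x" if "x \<in> ?A" for x using that h(2)[of x] by (simp add: \<phi>_def)
  have hB: "h x = x" if "x \<in> ?B" for x using that ab h(2)[of x] by (auto simp: \<phi>_def)
  let ?a = "g \<circ> a \<circ> inv' g"
  have ma: "moved ?a = h ` ?A"
    using moved_conj[OF g] hA by (metis (no_types, lifting) image_cong)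
  have mb: "?B = h ` ?B" using hB by auto
  have hi: "h x \<in> h ` U \<longleftrightarrow> x \<in> U" for x U using permutes_inj[OF h(1)] by (simp add: inj_image_mem_iff)
  have ga: "?a (g x) = g (a x)" for x using permutes_inverses(2)[OF g] by simp
  have *: "h (a (b x)) = ?a (b (h x))" for x
  proof -
    consider "x \<in> ?A" | "x \<in> ?B" | "x \<notin> ?A" "x \<notin> ?B" by blast
    then show ?thesis
    proof cases
      case 1
      then have "b x = x" using ab by blast
      moreover have "b (h x) = h x" using 1 gab hA[OF 1] by blast
      ultimately show ?thesis using hA[OF 1] hA[OF moved_image[OF a 1]] ga by simp
    next
      case 2
      have bx: "b x \<in> ?B" by (rule moved_image[OF b 2])
      then have "a (b x) = b x" using ab by blast
      moreover have "?a (b x) = b x" using bx gab moved_conj[OF g, of a] by blast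
      ultimately show ?thesis using hB[OF 2] hB[OF bx] by (simp only:)
    next
      case 3
      have "h x \<notin> moved ?a" unfolding ma hi by (rule 3(1))
      moreover have "h x \<notin> ?B" by (subst mb) (unfold hi, rule 3(2))
      ultimately have "?a (h x) = h x" "b (h x) = h x" by blast+
      moreover have "a x = x" "b x = x" using 3 by blast+
      ultimately show ?thesis by (simp only:)
    qed
  qed
  have "h \<circ> (a \<circ> b) \<circ> inv' h = ?a \<circ> b"
  proof
    fix x show "(h \<circ> (a \<circ> b) \<circ> inv' h) x = (?a \<circ> b) x"
      using *[of "inv' h x"] permutes_inverses(1)[OF h(1), of x] by simp
  qed
  with h(1) show ?thesis by (rule that)
qed

lemma cycle_or_disjoint_product:
  assumes "p permutes S" "finite S" "p \<noteq> id"
  shows "(\<exists>cs. cycle cs \<and> set cs \<subseteq> S \<and> 2 \<le> length cs \<and> p = cycle_of_list cs) \<or>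
    (\<exists>a b. a permutes S \<and> b permutes S \<and> a \<noteq> id \<and> b \<noteq> id \<and> moved a \<inter> moved b = {} \<and> p = a \<circ> b)"
proof -
  have "p permutes S \<and> (p = id \<or>
    (\<exists>cs. cycle cs \<and> set cs \<subseteq> S \<and> 2 \<le> length cs \<and> p = cycle_of_list cs) \<or>
    (\<exists>a b. a permutes S \<and> b permutes S \<and> a \<noteq> id \<and> b \<noteq> id \<and> moved a \<inter> moved b = {} \<and> p = a \<circ> b))"
    using cycle_decomposition[OF assms(1,2)]
  proof (induction S p rule: cycle_decomp.induct)
    case empty
    show ?case by (intro conjI disjI1 permutes_id refl)
  next
    case (comp I p cs)
    let ?c = "cycle_of_list cs" and ?S = "set cs \<union> I"
    have c: "?c permutes ?S" and p: "p permutes ?S"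
      using cycle_permutes[of cs] comp.IH by (auto elim: permutes_subset)
    have cp: "?c \<circ> p permutes ?S" using p c by (rule permutes_compose)
    show ?case
    proof (cases "length cs < 2")
      case True
      then have "?c = id" by (cases cs rule: cycle_of_list.cases) auto
      then have c_p: "?c \<circ> p = p" by simp
      have up: "a permutes ?S" if "a permutes I" for a
        using that by (rule permutes_subset) simp
      from comp.IH consider "p = id"
        | cs' where "cycle cs'" "set cs' \<subseteq> I" "2 \<le> length cs'" "p = cycle_of_list cs'"
        | a b where "a permutes I" "b permutes I" "a \<noteq> id" "b \<noteq> id" "moved a \<inter> moved b = {}" "p = a \<circ> b"
        by blast
      then have "p permutes ?S \<and> (p = id \<or>
        (\<exists>cs. cycle cs \<and> set cs \<subseteq> ?S \<and> 2 \<le> length cs \<and> p = cycle_of_list cs) \<or>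
        (\<exists>a b. a permutes ?S \<and> b permutes ?S \<and> a \<noteq> id \<and> b \<noteq> id \<and> moved a \<inter> moved b = {} \<and> p = a \<circ> b))"
      proof cases
        case (2 cs')
        have "set cs' \<subseteq> ?S" using 2(2) by blast
        with 2(1,3,4) show ?thesis using p by blast
      next
        case (3 a b)
        then show ?thesis
          using p up[OF 3(1)] up[OF 3(2)] by (intro conjI disjI2 exI[of _ a] exI[of _ b])
      qed (use p in blast)
      then show ?thesis unfolding c_p .
    next
      case long: False
      then obtain i j r where cs: "cs = i # j # r" by (cases cs rule: cycle_of_list.cases) auto
      have nid: "?c \<noteq> id"
      proof
        assume "?c = id"
        then have "rotate1 cs = cs"
          using cyclic_rotation[OF comp.hyps(2), of "Suc 0"] by (simp add: rotate_def)
        then show False using comp.hyps(2) by (simp add: cs)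
      qed
      have dis: "moved ?c \<inter> moved p = {}"
        using moved_subset[OF cycle_permutes[of cs]] moved_subset[of p I] comp.IH comp.hyps(3) by blast
      show ?thesis
      proof (cases "p = id")
        case True
        then have "?c \<circ> p = ?c" by simp
        moreover have "set cs \<subseteq> ?S" "2 \<le> length cs" using long by auto
        ultimately show ?thesis using cp comp.hyps(2) by blast
      next
        case False
        then show ?thesis using cp c p nid dis by blast
      qed
    qed
  qed
  then show ?thesis using assms(3) by blast
qed


section \<open>Propagation of zeros to all odd permutations\<close>

text \<open>
  The properties of an irreducible character that carry its zeros from one conjugacy class to
  another: it is a class function, and a zero at \<open>a\<close> makes its average over the products of \<open>b\<close> with
  the conjugates of \<open>a\<close> vanish.
\<close>

locale central_function =
  fixes n :: nat and X :: "(nat \<Rightarrow> nat) \<Rightarrow> 'k::field_char_0"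
  assumes conj: "p permutes {1..n} \<Longrightarrow> q permutes {1..n} \<Longrightarrow> X (q \<circ> p \<circ> inv' q) = X p"
    and product: "a permutes {1..n} \<Longrightarrow> b permutes {1..n} \<Longrightarrow> X a = 0 \<Longrightarrow>
      (\<Sum>g | g permutes {1..n}. X (g \<circ> a \<circ> inv' g \<circ> b)) = 0"
begin

text \<open>
  If all products of \<open>b\<close> with conjugates of \<open>a\<close> have value \<open>0\<close> or \<open>y\<close>, then a positive integer
  multiple of \<open>y\<close> is \<open>0\<close>.
\<close>

lemma eq_0_by_products:
  assumes a: "a permutes {1..n}" "X a = 0" and b: "b permutes {1..n}"
    and val: "\<And>g. g permutes {1..n} \<Longrightarrow>
      X (g \<circ> a \<circ> inv' g \<circ> b) = 0 \<or> X (g \<circ> a \<circ> inv' g \<circ> b) = y"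
    and g0: "g0 permutes {1..n}" "X (g0 \<circ> a \<circ> inv' g0 \<circ> b) = y"
  shows "y = 0"
proof (rule ccontr)
  assume y: "y \<noteq> 0"
  let ?G = "{g. g permutes {1..n}}"
  define H where "H = {g \<in> ?G. X (g \<circ> a \<circ> inv' g \<circ> b) = y}"
  have fin: "finite ?G" by (rule finite_permutations) simp
  have "0 = (\<Sum>g\<in>?G. X (g \<circ> a \<circ> inv' g \<circ> b))" using product[OF a(1) b a(2)] by simp
  also have "\<dots> = (\<Sum>g\<in>?G. if X (g \<circ> a \<circ> inv' g \<circ> b) = y then y else 0)"
    using val by (intro sum.cong refl) auto
  also have "\<dots> = (\<Sum>g\<in>H. y)" unfolding H_def using fin by (rule sum.inter_filter[symmetric])
  also have "\<dots> = of_nat (card H) * y" by simp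
  finally have "card H = 0" using y by simp
  moreover have "finite H" unfolding H_def by (rule finite_subset[OF _ fin]) blast
  moreover have "g0 \<in> H" unfolding H_def using g0 by blast
  ultimately show False by auto
qed

text \<open>
  Multiply \<open>b\<close> by the conjugates of \<open>a\<close>. If the moved points stay disjoint, the product is conjugate
  to \<open>a \<circ> b\<close>; otherwise it moves fewer points, is still odd, and has value \<open>0\<close> by the induction
  hypothesis. The factor \<open>a\<close> is itself odd and moves fewer points, so its value is \<open>0\<close> as well.
\<close>

lemma disjoint_product_eq_0:
  assumes a: "a permutes {1..n}" and b: "b permutes {1..n}" and "b \<noteq> id"
    and dis: "moved a \<inter> moved b = {}" and sgn: "sign a = - 1" "sign b = 1"
    and IH: "\<And>p. p permutes {1..n} \<Longrightarrow> sign p = - 1 \<Longrightarrow> card (moved p) < card (moved (a \<circ> b)) \<Longrightarrow> X p = 0"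
  shows "X (a \<circ> b) = 0"
proof (rule eq_0_by_products[OF a _ b _ permutes_id])
  have fin: "finite (moved a)" "finite (moved b)"
    using moved_subset[OF a] moved_subset[OF b] finite_subset by blast+
  have card: "card (moved (a \<circ> b)) = card (moved a) + card (moved b)"
    using moved_disjoint_comp[OF a b dis] card_Un_disjoint[OF fin dis] by metis
  have "moved b \<noteq> {}" using assms(3) moved_empty_iff[of b] by simp
  then have "card (moved b) \<noteq> 0" using fin(2) card_0_eq by blast
  then have "card (moved a) < card (moved (a \<circ> b))" using card by linarith
  then show "X a = 0" by (intro IH a sgn)
  show "X (id \<circ> a \<circ> inv' id \<circ> b) = X (a \<circ> b)" by simp
  fix g :: "nat \<Rightarrow> nat" assume g: "g permutes {1..n}"
  let ?a = "g \<circ> a \<circ> inv' g"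
  show "X (?a \<circ> b) = 0 \<or> X (?a \<circ> b) = X (a \<circ> b)"
  proof (cases "g ` moved a \<inter> moved b = {}")
    case True
    obtain h where "h permutes {1..n}" "h \<circ> (a \<circ> b) \<circ> inv' h = ?a \<circ> b"
      using disjoint_product_conj[OF _ a b g dis True] by blast
    then show ?thesis using conj[OF permutes_compose[OF b a]] by metis
  next
    case False
    have a': "?a permutes {1..n}" by (rule conj_permutes[OF g a])
    have perms: "permutation a" "permutation b" "permutation g"
      using a b g by (auto simp: permutation_permutes)
    have "moved (?a \<circ> b) \<subseteq> g ` moved a \<union> moved b"
      using moved_comp_subset[of ?a b] unfolding moved_conj[OF g] .
    then have "card (moved (?a \<circ> b)) \<le> card (g ` moved a \<union> moved b)"
      by (rule card_mono[rotated]) (intro finite_UnI finite_imageI fin)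
    also have "\<dots> < card (g ` moved a) + card (moved b)"
    proof -
      have "finite (g ` moved a \<inter> moved b)" using fin(2) by (rule finite_Int[OF disjI2])
      from card_0_eq[OF this] have "card (g ` moved a \<inter> moved b) \<noteq> 0" using False by (simp only: not_False_eq_True)
      then show ?thesis using card_Un_Int[of "g ` moved a" "moved b"] fin(2) finite_imageI[OF fin(1), of g]
        by linarith
    qed
    also have "card (g ` moved a) = card (moved a)"
      by (rule card_image) (rule permutes_inj_on[OF g])
    finally have "card (moved (?a \<circ> b)) < card (moved (a \<circ> b))" using card by linarith
    moreover have "sign (?a \<circ> b) = - 1"
    proof -
      have "sign ?a = sign g * sign a * sign g"
        using perms by (simp only: sign_compose permutation_compose permutation_inverse sign_inverse)
      moreover have "sign (?a \<circ> b) = sign ?a * sign b"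
        by (intro sign_compose permutation_compose permutation_inverse perms)
      ultimately show ?thesis using sgn by (simp add: sign_def split: if_splits)
    qed
    ultimately show ?thesis using IH[OF permutes_compose[OF b a']] by blast
  qed
qed

lemma cycle_eq:
  assumes "cycle cs" "set cs \<subseteq> {1..n}" "cycle ds" "set ds \<subseteq> {1..n}" "length cs = length ds"
  shows "X (cycle_of_list cs) = X (cycle_of_list ds)"
proof -
  obtain h where h: "h permutes {1..n}" "map h cs = ds"
    using list_to_list_permutation[OF _ assms] by blast
  have "X (h \<circ> cycle_of_list cs \<circ> inv' h) = X (cycle_of_list cs)"
    using cycle_permutes[of cs] assms(2) by (intro conj h(1)) (rule permutes_subset)
  then show ?thesis using conjugation_of_cycle[OF assms(1) permutes_bij[OF h(1)]] h(2) by simp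
qed

lemma cycle_times_transposition_eq:
  assumes cs: "cycle (cs @ [x, y])" "set (cs @ [x, y]) \<subseteq> {1..n}"
    and ds: "cycle (ds @ [u, v])" "set (ds @ [u, v]) \<subseteq> {1..n}" and len: "length cs = length ds"
  shows "X (cycle_of_list cs \<circ> cycle_of_list [x, y]) = X (cycle_of_list ds \<circ> cycle_of_list [u, v])"
proof -
  obtain h where h: "h permutes {1..n}" "map h (cs @ [x, y]) = ds @ [u, v]"
    using list_to_list_permutation[OF _ cs ds] len by auto
  then have m: "map h cs = ds" "map h [x, y] = [u, v]" using len by auto
  let ?c = "cycle_of_list cs" and ?d = "cycle_of_list [x, y]"
  have p: "?c permutes {1..n}" "?d permutes {1..n}"
    using cycle_permutes[of cs] cycle_permutes[of "[x, y]"] cs(2) by (auto elim!: permutes_subset simp del: cycle_of_list.simps)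
  have "h \<circ> (?c \<circ> ?d) \<circ> inv' h = (h \<circ> ?c \<circ> inv' h) \<circ> (h \<circ> ?d \<circ> inv' h)"
    using permutes_inverses(2)[OF h(1)] by (simp add: fun_eq_iff)
  also have "\<dots> = cycle_of_list (map h cs) \<circ> cycle_of_list (map h [x, y])"
    using cs(1) by (simp only: conjugation_of_cycle[OF _ permutes_bij[OF h(1)]] distinct_append)
  finally have "h \<circ> (?c \<circ> ?d) \<circ> inv' h = cycle_of_list ds \<circ> cycle_of_list [u, v]"
    unfolding m .
  then show ?thesis using conj[OF permutes_compose[OF p(2,1)] h(1)] by metis
qed

text \<open>
  Cycles of length \<open>2 * j\<close> with \<open>\<not> l dvd j\<close> are conjugate to members of \<open>Z_set l n\<close>. For
  \<open>j = k * l\<close> multiply a cycle \<open>b\<close> of length \<open>2 * j - 1\<close> by all transpositions \<open>(u v)\<close>, whose value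
  is \<open>0\<close> because \<open>\<not> l dvd 1\<close> puts \<open>(1 2)\<close> into \<open>Z_set l n\<close>. If exactly one of \<open>u\<close>, \<open>v\<close> is on \<open>b\<close>, the product is a cycle of length
  \<open>2 * j\<close>; if both are, it moves fewer points; if neither is, it is conjugate to the element
  \<open>(1 \<dots> 2kl-1)(2kl 2kl+1)\<close> of \<open>Z_set l n\<close>, and the
  points of \<open>b\<close> together with \<open>u\<close> and \<open>v\<close> show that \<open>2 * k * l < n\<close>.
\<close>

lemma even_cycle_eq_0:
  assumes l: "1 < l" and Z: "\<And>p. p \<in> Z_set l n \<Longrightarrow> X p = 0"
    and cs: "cycle cs" "set cs \<subseteq> {1..n}" "even (length cs)" "cs \<noteq> []"
    and IH: "\<And>p. p permutes {1..n} \<Longrightarrow> sign p = - 1 \<Longrightarrow> card (moved p) < length cs \<Longrightarrow> X p = 0"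
  shows "X (cycle_of_list cs) = 0"
proof -
  have "length cs \<noteq> 0" using cs(4) by simp
  obtain j where "length cs = 2 * j" using cs(3) by (elim evenE)
  with \<open>length cs \<noteq> 0\<close> have j: "length cs = 2 * j" "1 \<le> j" by linarith+
  have jn: "2 * j \<le> n" using card_mono[OF _ cs(2)] distinct_card[OF cs(1)] j by simp
  show ?thesis
  proof (cases "l dvd j")
    case False
    then have "cycle_of_list [1..<2 * j + 1] \<in> Z_set l n"
      using j(2) jn unfolding Z_set_def by (intro UnI1 CollectI exI[of _ j] conjI refl)
    then have "X (cycle_of_list [1..<2 * j + 1]) = 0" by (rule Z)
    moreover have "X (cycle_of_list cs) = X (cycle_of_list [1..<2 * j + 1])"
      using cs jn j by (intro cycle_eq) auto
    ultimately show ?thesis by simp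
  next
    case True
    define k where "k = j div l"
    have k: "j = k * l" using True by (simp add: k_def)
    obtain c0 c1 r where cs_eq: "cs = c0 # c1 # r"
      using j by (cases cs rule: cycle_of_list.cases) auto
    define ds where "ds = c1 # r"
    have ds: "cycle ds" "set ds \<subseteq> {1..n}" "length ds = 2 * j - 1" "c0 \<notin> set ds" "c0 \<in> {1..n}" "c1 \<in> set ds"
      using cs j by (auto simp: cs_eq ds_def)
    let ?a = "cycle_of_list [1, 2 :: nat]" and ?b = "cycle_of_list ds"
    have n2: "2 \<le> n" using jn j by simp
    have a: "?a permutes {1..n}"
      by (rule permutes_subset[OF cycle_permutes]) (use n2 in auto)
    have b: "?b permutes {1..n}" using cycle_permutes[of ds] ds(2) by (rule permutes_subset)
    have a_conj: "g \<circ> ?a \<circ> inv' g = transpose (g 1) (g 2)" if "g permutes {1..n}" for g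
      using conjugation_of_cycle[of "[1, 2 :: nat]", OF _ permutes_bij[OF that]] by simp
    have cs_cyc: "X (transpose u v \<circ> ?b) = X (cycle_of_list cs)"
      if uv: "u \<in> set ds" "v \<notin> set ds" "v \<in> {1..n}" for u v
    proof -
      obtain ds' where ds': "cycle (u # ds')" "set (u # ds') = set ds" "length (u # ds') = length ds"
        "cycle_of_list (u # ds') = ?b"
        using cycle_of_list_starting_at[OF ds(1) uv(1)] by blast
      have "transpose u v \<circ> ?b = cycle_of_list (v # u # ds')"
        using ds'(4) by (simp add: transpose_commute)
      moreover have "X (cycle_of_list (v # u # ds')) = X (cycle_of_list cs)"
        using ds'(1-3) uv(2,3) ds(2,3) cs(1,2) j by (intro cycle_eq) auto
      ultimately show ?thesis by simp
    qed
    \<comment> \<open>Conjugating \<open>(1 2)\<close> by \<open>g0\<close> extends the cycle \<open>ds\<close> by the point \<open>c0\<close>, so the value at \<open>cs\<close> occurs.\<close>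
    obtain g0 where g0: "g0 permutes {1..n}" "map g0 [1, 2] = [c1, c0]"
      using list_to_list_permutation[of "{1..n}" "[1, 2]" "[c1, c0]"] n2 cs cs_eq by auto
    show ?thesis
    proof (rule eq_0_by_products[OF a _ b])
      have "\<not> l dvd 1" using l by auto
      moreover have "[1..<2 * 1 + 1] = [1, 2 :: nat]" by (simp add: upt_rec)
      ultimately have "?a \<in> Z_set l n"
        using n2 unfolding Z_set_def by (intro UnI1 CollectI exI[of _ 1] conjI) simp_all
      then show "X ?a = 0" by (rule Z)
      show "g0 permutes {1..n}" by (rule g0(1))
      show "X (g0 \<circ> ?a \<circ> inv' g0 \<circ> ?b) = X (cycle_of_list cs)"
        unfolding a_conj[OF g0(1)] using g0(2) cs_cyc[OF ds(6,4,5)] by simp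
      fix g :: "nat \<Rightarrow> nat" assume g: "g permutes {1..n}"
      define u v where uv: "u = g 1" "v = g 2"
      have uvn: "u \<in> {1..n}" "v \<in> {1..n}" "u \<noteq> v"
        unfolding uv using permutes_in_image[OF g] n2 permutes_inj[OF g] by (auto dest: injD)
      have "X (transpose u v \<circ> ?b) = 0 \<or> X (transpose u v \<circ> ?b) = X (cycle_of_list cs)"
      proof -
        consider "u \<in> set ds" "v \<in> set ds" | "u \<in> set ds" "v \<notin> set ds" | "u \<notin> set ds" "v \<in> set ds"
          | "u \<notin> set ds" "v \<notin> set ds" by blast
        then show ?thesis
        proof cases
          case 1
          have "moved (transpose u v \<circ> ?b) \<subseteq> set ds"
            by (rule moved_subset) (intro permutes_compose cycle_permutes permutes_swap_id 1)
          then have "card (moved (transpose u v \<circ> ?b)) \<le> length ds"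
            using card_mono[OF finite_set] distinct_card[OF ds(1)] by metis
          then have "card (moved (transpose u v \<circ> ?b)) < length cs" using ds(3) j by linarith
          moreover have "sign (transpose u v \<circ> ?b) = - 1"
            using uvn(3) ds(3) j
            by (simp add: sign_compose[OF permutation_swap_id permutation_of_cycle] sign_swap_id
                sign_cycle_of_list[OF ds(1)] del: o_apply)
          moreover have "transpose u v \<circ> ?b permutes {1..n}"
            by (intro permutes_compose b permutes_swap_id uvn)
          ultimately show ?thesis using IH by blast
        next
          case 2
          then show ?thesis using cs_cyc uvn by blast
        next
          case 3
          then show ?thesis using cs_cyc[of v u] uvn by (simp add: transpose_commute)
        next
          case 4
          let ?m = "2 * k * l"
          have m: "?m = 2 * j" by (simp add: k)
          have "card ({u, v} \<union> set ds) = 2 * j + 1"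
            using 4 uvn(3) distinct_card[OF ds(1)] ds(3) j by simp
          then have mn: "?m < n" using card_mono[of "{1..n}" "{u, v} \<union> set ds"] uvn ds(2) m by simp
          have "cycle_of_list [1..<?m] \<circ> cycle_of_list [?m, ?m + 1] \<in> Z_set l n"
          proof -
            have "1 \<le> k" using j(2) k by (cases k) simp_all
            moreover have "1 < ?m" using m j(2) by linarith
            ultimately show ?thesis
              using mn unfolding Z_set_def by (intro UnI2 CollectI exI[of _ k] conjI refl)
          qed
          then have "X (cycle_of_list [1..<?m] \<circ> cycle_of_list [?m, ?m + 1]) = 0" by (rule Z)
          moreover have "X (cycle_of_list [1..<?m] \<circ> cycle_of_list [?m, ?m + 1])
              = X (?b \<circ> cycle_of_list [u, v])"
            using mn m j uvn 4 ds by (intro cycle_times_transposition_eq) auto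
          moreover have "?b \<circ> cycle_of_list [u, v] = cycle_of_list [u, v] \<circ> ?b"
            using 4 uvn ds(1) by (intro cycles_commute) auto
          ultimately show ?thesis by simp
        qed
      qed
      then show "X (g \<circ> ?a \<circ> inv' g \<circ> ?b) = 0 \<or> X (g \<circ> ?a \<circ> inv' g \<circ> ?b) = X (cycle_of_list cs)"
        unfolding a_conj[OF g] uv .
    qed
  qed
qed

text \<open>
  Induction on the number of moved points: an odd permutation is a cycle of even length or a
  product of two disjoint nontrivial permutations, exactly one of which is odd.
\<close>

lemma odd_eq_0:
  assumes l: "1 < l" and Z: "\<And>p. p \<in> Z_set l n \<Longrightarrow> X p = 0"
    and "p permutes {1..n}" "sign p = - 1"
  shows "X p = 0"
  using assms(3,4)
proof (induction "card (moved p)" arbitrary: p rule: less_induct)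
  case less
  have "p \<noteq> id" using less.prems by auto
  from cycle_or_disjoint_product[OF less.prems(1) _ this]
  consider (cycle) cs where "cycle cs" "set cs \<subseteq> {1..n}" "2 \<le> length cs" "p = cycle_of_list cs"
    | (prod) a b where "a permutes {1..n}" "b permutes {1..n}" "a \<noteq> id" "b \<noteq> id"
        "moved a \<inter> moved b = {}" "p = a \<circ> b"
    by auto
  then show ?case
  proof cases
    case cycle
    have ev: "even (length cs)"
    proof (rule ccontr)
      assume "odd (length cs)"
      then have "sign p = 1" using sign_cycle_of_list[OF cycle(1)] cycle(3,4) by simp
      with less.prems show False by simp
    qed
    have card: "card (moved p) = length cs"
    proof -
      have "moved p = set cs"
      proof (intro equalityI subsetI)
        fix x assume "x \<in> moved p"
        then show "x \<in> set cs" using moved_subset[OF cycle_permutes[of cs]] cycle(4) by blast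
      next
        fix x assume x: "x \<in> set cs"
        obtain r where r: "cycle (x # r)" "length (x # r) = length cs" "cycle_of_list (x # r) = p"
          using cycle_of_list_starting_at[OF cycle(1) x] cycle(4) by metis
        have "map p (x # r) = rotate1 (x # r)" using cyclic_rotation[OF r(1), of "Suc 0"] r(3) by (simp add: rotate_def)
        then show "x \<in> moved p" using r(1,2) cycle(3) by (cases r) auto
      qed
      then show ?thesis using distinct_card[OF cycle(1)] by simp
    qed
    have "cs \<noteq> []" using cycle(3) by auto
    then show ?thesis
      unfolding cycle(4) using less.hyps[unfolded card]
      by (intro even_cycle_eq_0[OF l Z cycle(1,2) ev])
  next
    case prod
    have perms: "permutation a" "permutation b" using prod by (auto simp: permutation_permutes)
    have "sign a * sign b = - 1" using less.prems(2) sign_compose[OF perms] prod(6) by simp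
    then consider "sign a = - 1" "sign b = 1" | "sign b = - 1" "sign a = 1"
      by (auto simp: sign_def split: if_splits)
    then show ?thesis
    proof cases
      case 1
      show ?thesis
        unfolding prod(6)
        by (rule disjoint_product_eq_0[OF prod(1,2,4,5) 1]) (rule less.hyps[unfolded prod(6)])
    next
      case 2
      have "p = b \<circ> a" using disjoint_comp_commute[OF prod(1,2,5)] prod(6) by simp
      have "moved b \<inter> moved a = {}" using prod(5) by (simp only: Int_commute)
      then show ?thesis
        unfolding \<open>p = b \<circ> a\<close>
        by (rule disjoint_product_eq_0[OF prod(2,1,3) _ 2]) (rule less.hyps[unfolded \<open>p = b \<circ> a\<close>])
    qed
  qed
qed

end


section \<open>The trace of a Young symmetrizer\<close>

definition row_stabilizer :: "nat list \<Rightarrow> (nat \<times> nat \<Rightarrow> nat) \<Rightarrow> (nat \<Rightarrow> nat) set" where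
  "row_stabilizer lam t = set_stabilizer (sum_list lam) (row_entries lam t)"

lemma row_stabilizer_permutes: "r \<in> row_stabilizer lam t \<Longrightarrow> r permutes {1..sum_list lam}"
  unfolding row_stabilizer_def by (rule set_stabilizer_permutes)

lemma column_stabilizer_permutes: "p \<in> column_stabilizer lam t \<Longrightarrow> p permutes {1..sum_list lam}"
  unfolding column_stabilizer_eq by (rule set_stabilizer_permutes)

lemma finite_row_stabilizer: "finite (row_stabilizer lam t)"
  unfolding row_stabilizer_def by (rule finite_set_stabilizer)

lemma perm_comb_comp:
  fixes v :: "tabloid \<Rightarrow> 'k::field"
  assumes "\<And>p. p \<in> P \<Longrightarrow> bij p" "\<And>q. q \<in> Q \<Longrightarrow> bij q"
  shows "perm_comb P w (perm_comb Q u v)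
    = (\<Sum>i\<in>P \<times> Q. fscale (w (fst i) * u (snd i)) (perm_act (fst i \<circ> snd i) v))"
proof -
  have *: "fscale (w p) (perm_act p (perm_comb Q u v))
      = (\<Sum>q\<in>Q. fscale (w p * u q) (perm_act (p \<circ> q) v))" if p: "p \<in> P" for p
  proof -
    interpret L: Vector_Spaces.linear fscale fscale "perm_act p :: (tabloid \<Rightarrow> 'k) \<Rightarrow> _"
      by (rule linear_perm_act)
    show ?thesis
      unfolding perm_comb_def L.sum L.scale fun_vs.scale_sum_right
      by (intro sum.cong refl) (simp only: perm_act_comp[OF assms(1)[OF p] assms(2)] fun_vs.scale_scale)
  qed
  have "perm_comb P w (perm_comb Q u v)
      = (\<Sum>p\<in>P. \<Sum>q\<in>Q. fscale (w p * u q) (perm_act (p \<circ> q) v))"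
    unfolding perm_comb_def[of P] by (intro sum.cong refl) (rule *)
  then show ?thesis by (simp only: sum.cartesian_product case_prod_unfold)
qed

lemma trace_perm_comb_comp:
  assumes "\<And>p. p \<in> P \<Longrightarrow> p permutes {1..sum_list lam}" "\<And>q. q \<in> Q \<Longrightarrow> q permutes {1..sum_list lam}"
  shows "trace_on (specht_module lam) (\<lambda>v. perm_comb P w (perm_comb Q u v))
    = (\<Sum>i\<in>P \<times> Q. w (fst i) * u (snd i) * (specht_character lam (fst i \<circ> snd i) :: 'k::field_char_0))"
proof -
  have "(\<lambda>v :: tabloid \<Rightarrow> 'k. perm_comb P w (perm_comb Q u v))
      = (\<lambda>v. \<Sum>i\<in>P \<times> Q. fscale (w (fst i) * u (snd i)) (perm_act (fst i \<circ> snd i) v))"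
    by (rule ext) (intro perm_comb_comp permutes_bij; rule assms; assumption)
  moreover have "fst i \<circ> snd i permutes {1..sum_list lam}" if "i \<in> P \<times> Q" for i
    using that assms by (intro permutes_compose) auto
  ultimately show ?thesis by (simp only: trace_perm_sum)
qed

text \<open>
  If \<open>\<chi>\<close> vanishes on odd permutations, then \<open>\<chi> (p q) \<noteq> 0\<close> forces \<open>p\<close> and \<open>q\<close> to have the same sign,
  and the sign may be moved from \<open>p\<close> to \<open>q\<close>.
\<close>

lemma trace_sign_swap:
  assumes odd: "\<And>p. p permutes {1..sum_list lam} \<Longrightarrow> sign p = - 1 \<Longrightarrow> specht_character lam p = (0 :: 'k::field_char_0)"
    and P: "\<And>p. p \<in> P \<Longrightarrow> p permutes {1..sum_list lam}" and Q: "\<And>q. q \<in> Q \<Longrightarrow> q permutes {1..sum_list lam}"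
  shows "trace_on (specht_module lam :: (tabloid \<Rightarrow> 'k) set) (\<lambda>v. perm_comb P sgn_weight (perm_comb Q (\<lambda>_. 1) v))
    = trace_on (specht_module lam) (\<lambda>v. perm_comb P (\<lambda>_. 1) (perm_comb Q sgn_weight v))"
proof -
  have tr: "trace_on (specht_module lam) (\<lambda>v. perm_comb P w (perm_comb Q u v))
      = (\<Sum>i\<in>P \<times> Q. w (fst i) * u (snd i) * (specht_character lam (fst i \<circ> snd i) :: 'k))" for w u
    by (rule trace_perm_comb_comp) (rule P Q, assumption)+
  show ?thesis
    unfolding tr
  proof (intro sum.cong refl)
    fix i assume "i \<in> P \<times> Q"
    then have p: "fst i permutes {1..sum_list lam}" and q: "snd i permutes {1..sum_list lam}"
      using P Q by auto
    show "sgn_weight (fst i) * 1 * specht_character lam (fst i \<circ> snd i)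
        = 1 * sgn_weight (snd i) * (specht_character lam (fst i \<circ> snd i) :: 'k)"
    proof (cases "sign (fst i) = sign (snd i)")
      case False
      have "permutation (fst i)" "permutation (snd i)" using p q by (auto simp: permutation_permutes)
      then have "sign (fst i \<circ> snd i) = sign (fst i) * sign (snd i)" by (rule sign_compose)
      also have "\<dots> = - 1" using False by (auto simp: sign_def split: if_splits)
      finally have "specht_character lam (fst i \<circ> snd i) = (0 :: 'k)"
        by (intro odd permutes_compose p q)
      then show ?thesis by (simp only: mult_zero_right)
    qed (simp only: mult_1_left mult_1_right)
  qed
qed

lemma Ints_sum_squares_eq_0:
  fixes f :: "'a \<Rightarrow> 'k::field_char_0"
  assumes A: "finite A" and f: "\<And>x. x \<in> A \<Longrightarrow> f x \<in> \<int>" and 0: "(\<Sum>x\<in>A. f x * f x) = 0" and x: "x \<in> A"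
  shows "f x = 0"
proof -
  have "\<exists>g. \<forall>x\<in>A. f x = of_int (g x)" using f by (intro bchoice) (auto elim: Ints_cases)
  then obtain g where g: "\<And>x. x \<in> A \<Longrightarrow> f x = of_int (g x)" by blast
  have "of_int (\<Sum>x\<in>A. g x * g x) = (0 :: 'k)" using 0 g by simp
  then have "(\<Sum>x\<in>A. g x * g x) = 0" by (simp only: of_int_eq_0_iff)
  then have "g x * g x = 0" using A x by (subst (asm) sum_nonneg_eq_0_iff) auto
  then show ?thesis using g[OF x] by simp
qed

lemma tabloid_of_row_stabilizer:
  "r \<in> row_stabilizer lam t \<Longrightarrow> tabloid_of lam (r \<circ> t) = tabloid_of lam t"
  unfolding tabloid_of_def row_entries_comp by (simp add: row_stabilizer_def set_stabilizer_def)

text \<open>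
  The invariant bilinear form for which the tabloids are orthonormal.
\<close>

definition tabloid_inner :: "nat list \<Rightarrow> (tabloid \<Rightarrow> 'k::field) \<Rightarrow> (tabloid \<Rightarrow> 'k) \<Rightarrow> 'k" where
  "tabloid_inner lam u v = (\<Sum>T\<in>tabloid_of lam ` tableaux lam. u T * v T)"

lemma tabloid_inner_perm_act:
  assumes r: "r permutes {1..sum_list lam}"
  shows "tabloid_inner lam (perm_act r u) (perm_act r v) = tabloid_inner lam u v"
proof -
  let ?TT = "tabloid_of lam ` tableaux lam"
  have act: "(\<lambda>s. q \<circ> s) ` T \<in> ?TT" if "q permutes {1..sum_list lam}" "T \<in> ?TT" for q T
    using that tabloid_of_comp[OF that(1)] tableaux_comp[OF that(1)] by auto
  have ir: "inv' r permutes {1..sum_list lam}" using r by (rule permutes_inv)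
  have "bij_betw (\<lambda>T. (\<lambda>s. inv' r \<circ> s) ` T) ?TT ?TT"
    by (rule bij_betw_byWitness[where f' = "\<lambda>T. (\<lambda>s. r \<circ> s) ` T"])
      (use act[OF r] act[OF ir] in
        \<open>auto simp: image_image o_assoc permutes_inv_o[OF r] simp del: image_iff\<close>)
  from sum.reindex_bij_betw[OF this, of "\<lambda>T. u T * v T"]
  show ?thesis by (simp add: tabloid_inner_def perm_act_def)
qed

text \<open>
  The signed column sum \<open>\<kappa>\<close> of \<open>t\<close> is its own adjoint, so \<open>\<langle>\<kappa> {t}, v\<rangle> = \<langle>{t}, \<kappa> v\<rangle>\<close>.
\<close>

lemma tabloid_inner_polytabloid:
  assumes t: "t \<in> tableaux lam"
  shows "tabloid_inner lam (polytabloid lam t) v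
    = perm_comb (column_stabilizer lam t) sgn_weight v (tabloid_of lam t)"
proof -
  let ?TT = "tabloid_of lam ` tableaux lam" and ?C = "column_stabilizer lam t"
  have fin: "finite ?TT" using finite_tableaux by (rule finite_imageI)
  have "tabloid_inner lam (polytabloid lam t) v
      = (\<Sum>T\<in>?TT. \<Sum>p\<in>?C. if T = tabloid_of lam (p \<circ> t) then sgn_weight p * v T else 0)"
    by (auto simp: tabloid_inner_def polytabloid_def sum_fun_apply fscale_def tabloid_vec_def
        sum_distrib_right intro!: sum.cong)
  also have "\<dots> = (\<Sum>p\<in>?C. \<Sum>T\<in>?TT. if T = tabloid_of lam (p \<circ> t) then sgn_weight p * v T else 0)"
    by (rule sum.swap)
  also have "\<dots> = (\<Sum>p\<in>?C. sgn_weight p * v (tabloid_of lam (p \<circ> t)))"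
  proof (intro sum.cong refl)
    fix p assume "p \<in> ?C"
    then have "tabloid_of lam (p \<circ> t) \<in> ?TT"
      using tableaux_comp[OF column_stabilizer_permutes t] by blast
    then show "(\<Sum>T\<in>?TT. if T = tabloid_of lam (p \<circ> t) then sgn_weight p * v T else 0)
        = sgn_weight p * v (tabloid_of lam (p \<circ> t))"
      using fin by (simp add: sum.delta)
  qed
  also have "\<dots> = (\<Sum>p\<in>?C. sgn_weight p * v (tabloid_of lam (inv' p \<circ> t)))"
  proof (rule sum.reindex_bij_witness[of _ "\<lambda>p. inv' p" "\<lambda>p. inv' p"])
    fix p assume p: "p \<in> ?C"
    note perm = column_stabilizer_permutes[OF p]
    show inv: "inv' (inv' p) = p" using permutes_bij[OF perm] by (rule inv_inv_eq)
    show "inv' p \<in> ?C" using p unfolding column_stabilizer_eq by (rule set_stabilizer_inv)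
    have "permutation p" using perm by (auto simp: permutation_permutes)
    then show "sgn_weight (inv' p) * v (tabloid_of lam (inv' (inv' p) \<circ> t))
        = sgn_weight p * v (tabloid_of lam (p \<circ> t))"
      by (simp only: inv sign_inverse)
    show "inv' (inv' p) = p" by (rule inv)
    show "inv' p \<in> ?C" using p unfolding column_stabilizer_eq by (rule set_stabilizer_inv)
  qed
  also have "\<dots> = perm_comb ?C sgn_weight v (tabloid_of lam t)"
    unfolding perm_comb_def sum_fun_apply
  proof (intro sum.cong refl)
    fix p assume "p \<in> ?C"
    then have "inv' p permutes {1..sum_list lam}" by (intro permutes_inv column_stabilizer_permutes)
    then show "sgn_weight p * v (tabloid_of lam (inv' p \<circ> t))
        = fscale (sgn_weight p) (perm_act p v) (tabloid_of lam t)"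
      by (simp only: fscale_def perm_act_def tabloid_of_comp)
  qed
  finally show ?thesis .
qed

text \<open>
  Write \<open>\<kappa>\<close> for the signed column sum and \<open>\<rho>\<close> for the row sum of \<open>t\<close>, \<open>e\<close> for the polytabloid \<open>\<kappa> {t}\<close>
  and \<open>w = \<rho> e\<close>. As \<open>\<kappa> \<rho>\<close> maps into the line through \<open>e\<close>, its trace is the \<open>c\<close> with \<open>\<kappa> w = c e\<close>, and
  \<open>c = \<langle>e, w\<rangle>\<close> by self-adjointness. Row invariance of \<open>w\<close> gives \<open>\<langle>w, w\<rangle> = \<bar>R\<bar> * c\<close> for the row
  stabilizer \<open>R\<close>. The coordinates of \<open>w\<close> are integers and the one at the tabloid of \<open>t\<close> is \<open>\<bar>R\<bar>\<close>,
  so \<open>\<langle>w, w\<rangle>\<close> is a positive integer.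
\<close>

lemma trace_young_symmetrizer_nonzero:
  assumes lam: "sorted_wrt (\<ge>) lam" and t: "t \<in> tableaux lam"
  shows "trace_on (specht_module lam :: (tabloid \<Rightarrow> 'k::field_char_0) set)
    (\<lambda>v. perm_comb (column_stabilizer lam t) sgn_weight (perm_comb (row_stabilizer lam t) (\<lambda>_. 1) v)) \<noteq> 0"
proof -
  let ?V = "specht_module lam :: (tabloid \<Rightarrow> 'k) set"
  let ?TT = "tabloid_of lam ` tableaux lam" and ?C = "column_stabilizer lam t" and ?R = "row_stabilizer lam t"
  let ?e = "polytabloid lam t :: tabloid \<Rightarrow> 'k" and ?T = "tabloid_of lam t"
  let ?\<kappa> = "perm_comb ?C sgn_weight :: (tabloid \<Rightarrow> 'k) \<Rightarrow> _"
  let ?\<rho> = "perm_comb ?R (\<lambda>_. 1) :: (tabloid \<Rightarrow> 'k) \<Rightarrow> _"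
  define w where "w = ?\<rho> ?e"
  have e: "?e \<in> ?V" using t by (rule polytabloid_in)
  have \<rho>V: "?\<rho> v \<in> ?V" if "v \<in> ?V" for v
    using row_stabilizer_permutes that by (rule perm_comb_specht_module)
  have line: "\<exists>a. ?\<kappa> (?\<rho> v) = fscale a ?e" if "v \<in> ?V" for v
    using \<rho>V[OF that] specht_module_subset by (intro column_antisymmetrizer_line[OF lam t]) blast
  obtain c where c: "?\<kappa> w = fscale c ?e" using line[OF e] unfolding w_def by blast
  have "fun_linear (\<lambda>v. ?\<kappa> (?\<rho> v))"
    using Vector_Spaces.linear_compose[OF linear_perm_comb linear_perm_comb] by (simp only: o_def)
  then have tr: "trace_on ?V (\<lambda>v. ?\<kappa> (?\<rho> v)) = c"
    using c line unfolding w_def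
    by (intro trace_on_line[OF fin_dim_specht_module _ e polytabloid_nonzero[OF t]])
  have inner_e: "tabloid_inner lam ?e w = c"
    using polytabloid_at_own_tabloid[OF t, where 'k = 'k]
    by (simp add: tabloid_inner_polytabloid[OF t] c) (simp add: fscale_def)
  have w_sum: "w = (\<Sum>r\<in>?R. perm_act r ?e)" unfolding w_def perm_comb_def by simp
  have w_inv: "perm_act r w = w" if r: "r \<in> ?R" for r
  proof -
    interpret L: Vector_Spaces.linear fscale fscale "perm_act r :: (tabloid \<Rightarrow> 'k) \<Rightarrow> _"
      by (rule linear_perm_act)
    note pr = row_stabilizer_permutes[OF r]
    have mem: "r \<circ> q \<in> ?R" "inv' r \<circ> q \<in> ?R" if "q \<in> ?R" for q
      using r that unfolding row_stabilizer_def by (blast intro: set_stabilizer_comp set_stabilizer_inv)+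
    have inv: "inv' r \<circ> (r \<circ> q) = q" "r \<circ> (inv' r \<circ> q) = q" for q
      by (simp_all only: o_assoc permutes_inv_o[OF pr] id_comp)
    have "bij_betw (\<lambda>q. r \<circ> q) ?R ?R"
      by (rule bij_betw_byWitness[where f' = "\<lambda>q. inv' r \<circ> q"]) (use mem inv in \<open>auto simp del: o_apply\<close>)
    have "perm_act r w = (\<Sum>q\<in>?R. perm_act (r \<circ> q) ?e)"
      unfolding w_sum L.sum
      by (intro sum.cong refl perm_act_comp permutes_bij[OF pr] permutes_bij[OF row_stabilizer_permutes])
    also have "\<dots> = w" unfolding w_sum by (rule sum.reindex_bij_betw) fact
    finally show ?thesis .
  qed
  have "tabloid_inner lam w w = (\<Sum>r\<in>?R. tabloid_inner lam (perm_act r ?e) w)"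
    unfolding tabloid_inner_def by (subst (1) w_sum) (simp add: sum_fun_apply sum_distrib_right sum.swap[of _ ?R])
  also have "\<dots> = (\<Sum>r\<in>?R. c)"
  proof (intro sum.cong refl)
    fix r assume r: "r \<in> ?R"
    have "tabloid_inner lam (perm_act r ?e) w = tabloid_inner lam (perm_act r ?e) (perm_act r w)"
      by (simp only: w_inv[OF r])
    then show "tabloid_inner lam (perm_act r ?e) w = c"
      by (simp only: tabloid_inner_perm_act[OF row_stabilizer_permutes[OF r]] inner_e)
  qed
  finally have ww: "tabloid_inner lam w w = of_nat (card ?R) * c" by simp
  have "w ?T = (\<Sum>r\<in>?R. 1)"
    unfolding w_sum sum_fun_apply
  proof (intro sum.cong refl)
    fix r assume r: "r \<in> ?R"
    have ir: "inv' r \<in> ?R" using r unfolding row_stabilizer_def by (rule set_stabilizer_inv)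
    have "perm_act r ?e ?T = ?e (tabloid_of lam (inv' r \<circ> t))"
      by (simp only: perm_act_def tabloid_of_comp[OF row_stabilizer_permutes[OF ir]])
    then show "perm_act r ?e ?T = 1"
      by (simp only: tabloid_of_row_stabilizer[OF ir] polytabloid_at_own_tabloid[OF t])
  qed
  moreover have "id \<in> ?R" unfolding row_stabilizer_def by (rule id_set_stabilizer)
  then have "card ?R \<noteq> 0" using finite_row_stabilizer[of lam t] by auto
  ultimately have wT: "w ?T \<noteq> 0" by simp
  have "w T \<in> \<int>" for T
    unfolding w_sum sum_fun_apply perm_act_def polytabloid_def fscale_def tabloid_vec_def
    by (intro Ints_sum) auto
  then have "tabloid_inner lam w w \<noteq> 0"
    using Ints_sum_squares_eq_0[of ?TT w ?T] wT t finite_tableaux unfolding tabloid_inner_def by blast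
  then show ?thesis unfolding tr using ww by auto
qed

lemma fun_linear_span_nonzeroD:
  assumes f: "fun_linear f" and "v \<in> fun_vs.span S" "f v \<noteq> 0"
  shows "\<exists>s\<in>S. f s \<noteq> 0"
proof (rule ccontr)
  interpret f: Vector_Spaces.linear fscale fscale f by (rule f)
  assume "\<not> ?thesis"
  then have "S \<subseteq> {v. f v = 0}" by blast
  then have "fun_vs.span S \<subseteq> {v. f v = 0}"
    by (rule fun_vs.span_minimal) (rule f.subspace_kernel)
  with assms(2,3) show False by blast
qed


section \<open>Self-conjugacy from zeros on the odd permutations\<close>

lemma row_antisymmetrizer_nonzeroD:
  assumes t: "t \<in> tableaux lam" and s: "s \<in> tableaux lam"
    and nz: "perm_comb (row_stabilizer lam t) sgn_weight (tabloid_vec lam s) \<noteq> (0 :: tabloid \<Rightarrow> 'k::field_char_0)"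
  shows "inj_on (\<lambda>x. (fst (box_of lam s x), fst (box_of lam t x))) {1..sum_list lam}"
proof (rule inj_onI, rule ccontr)
  fix x y assume xy: "x \<in> {1..sum_list lam}" "y \<in> {1..sum_list lam}" "x \<noteq> y"
    and eq: "(fst (box_of lam s x), fst (box_of lam t x)) = (fst (box_of lam s y), fst (box_of lam t y))"
  have "perm_comb (row_stabilizer lam t) sgn_weight (tabloid_vec lam s) = (0 :: tabloid \<Rightarrow> 'k)"
    unfolding row_stabilizer_def
  proof (rule perm_comb_set_stabilizer_eq_0[where \<epsilon> = "- 1" and \<delta> = 1])
    show q: "transpose x y \<in> set_stabilizer (sum_list lam) (row_entries lam t)"
      using xy eq by (intro transpose_set_stabilizer) (auto simp: row_entries_box[OF t])
    show "sgn_weight (p \<circ> transpose x y) = (- 1 * sgn_weight p :: 'k)"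
      if "p \<in> set_stabilizer (sum_list lam) (row_entries lam t)" for p
      using sgn_weight_comp[OF set_stabilizer_permutes[OF that] set_stabilizer_permutes[OF q]] xy(3)
      by (simp add: sign_swap_id)
    show "perm_act (transpose x y) (tabloid_vec lam s) = fscale 1 (tabloid_vec lam s :: tabloid \<Rightarrow> 'k)"
      using perm_act_tabloid_vec_transpose[OF s xy(1,2)] eq by simp
  qed simp
  with nz show False ..
qed

text \<open>
  The column stabilizer of \<open>q \<circ> s\<close> is that of \<open>s\<close>, and the signed sum over it absorbs \<open>q\<close>.
\<close>

lemma perm_act_polytabloid_column:
  assumes s: "s \<in> tableaux lam" and q: "q \<in> column_stabilizer lam s"
  shows "perm_act q (polytabloid lam s) = fscale (sgn_weight q) (polytabloid lam s :: tabloid \<Rightarrow> 'k::field)"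
proof -
  let ?C = "column_stabilizer lam s"
  note qp = column_stabilizer_permutes[OF q]
  have C: "column_stabilizer lam (q \<circ> s) = ?C"
    unfolding column_stabilizer_def col_entries_comp using q by (simp add: column_stabilizer_def)
  have "polytabloid lam s = (perm_comb ?C sgn_weight (tabloid_vec lam s) :: tabloid \<Rightarrow> 'k)"
    by (rule polytabloid_eq_perm_comb)
  also have "\<dots> = fscale (sgn_weight q) (perm_comb ?C sgn_weight (perm_act q (tabloid_vec lam s)))"
  proof (rule perm_comb_absorb)
    show "bij_betw (\<lambda>p. p \<circ> q) ?C ?C"
      using q unfolding column_stabilizer_eq by (rule bij_betw_set_stabilizer_comp)
    show "bij p" if "p \<in> ?C" for p by (rule permutes_bij[OF column_stabilizer_permutes[OF that]])
    show "bij q" by (rule permutes_bij[OF qp])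
    show "sgn_weight (p \<circ> q) = (sgn_weight q * sgn_weight p :: 'k)" if "p \<in> ?C" for p
      by (rule sgn_weight_comp[OF column_stabilizer_permutes[OF that] qp])
  qed
  also have "\<dots> = fscale (sgn_weight q) (polytabloid lam (q \<circ> s))"
    unfolding polytabloid_eq_perm_comb[of lam "q \<circ> s"] C perm_act_tabloid_vec[OF qp] ..
  finally have "fscale (sgn_weight q) (polytabloid lam s)
      = fscale (sgn_weight q * sgn_weight q) (polytabloid lam (q \<circ> s) :: tabloid \<Rightarrow> 'k)"
    by (metis fun_vs.scale_scale)
  then show ?thesis
    unfolding perm_act_polytabloid[OF qp] by (simp only: sgn_weight_square fun_vs.scale_one)
qed

lemma column_symmetrizer_nonzeroD:
  assumes t: "t \<in> tableaux lam" and s: "s \<in> tableaux lam"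
    and nz: "perm_comb (column_stabilizer lam t) (\<lambda>_. 1) (polytabloid lam s) \<noteq> (0 :: tabloid \<Rightarrow> 'k::field_char_0)"
  shows "inj_on (\<lambda>x. (snd (box_of lam s x), snd (box_of lam t x))) {1..sum_list lam}"
proof (rule inj_onI, rule ccontr)
  fix x y assume xy: "x \<in> {1..sum_list lam}" "y \<in> {1..sum_list lam}" "x \<noteq> y"
    and eq: "(snd (box_of lam s x), snd (box_of lam t x)) = (snd (box_of lam s y), snd (box_of lam t y))"
  have "perm_comb (column_stabilizer lam t) (\<lambda>_. 1) (polytabloid lam s) = (0 :: tabloid \<Rightarrow> 'k)"
    unfolding column_stabilizer_eq
  proof (rule perm_comb_set_stabilizer_eq_0[where \<epsilon> = 1 and \<delta> = "- 1"])
    show "transpose x y \<in> set_stabilizer (sum_list lam) (col_entries lam t)"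
      using xy eq by (intro transpose_set_stabilizer) (auto simp: col_entries_box[OF t])
    have "transpose x y \<in> column_stabilizer lam s"
      unfolding column_stabilizer_eq
      using xy eq by (intro transpose_set_stabilizer) (auto simp: col_entries_box[OF s])
    then show "perm_act (transpose x y) (polytabloid lam s) = fscale (- 1) (polytabloid lam s :: tabloid \<Rightarrow> 'k)"
      using perm_act_polytabloid_column[OF s, where 'k = 'k] xy(3) by (simp add: sign_swap_id)
  qed simp_all
  with nz show False ..
qed

text \<open>
  Moving the sign in the Young symmetrizer from the columns to the rows keeps its nonzero trace.
  So some tabloid survives antisymmetrization over the rows of \<open>t\<close>, and some polytabloid survives
  symmetrization over the columns of \<open>t\<close>. Survival means that two rows, one of each tableau, share
  at most one entry in the first case, and two columns in the second. By \<open>count_below_le\<close> the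
  partial sums of the row lengths are therefore at most those of the column lengths, and conversely.
\<close>

lemma row_lengths_eq_column_lengths:
  assumes lam: "sorted_wrt (\<ge>) lam"
    and odd: "\<And>p. p permutes {1..sum_list lam} \<Longrightarrow> sign p = - 1 \<Longrightarrow> specht_character lam p = (0 :: 'k::field_char_0)"
  shows "card {c \<in> young_diagram lam. fst c = i} = card {c \<in> young_diagram lam. snd c = i}"
proof -
  let ?V = "specht_module lam :: (tabloid \<Rightarrow> 'k) set" and ?X = "{1..sum_list lam}" and ?D = "young_diagram lam"
  obtain t where t: "t \<in> tableaux lam" using exists_tableau by blast
  let ?C = "column_stabilizer lam t" and ?R = "row_stabilizer lam t"
  let ?f = "\<lambda>v :: tabloid \<Rightarrow> 'k. perm_comb ?C (\<lambda>_. 1) (perm_comb ?R sgn_weight v)"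
  have "trace_on ?V (\<lambda>v. perm_comb ?C sgn_weight (perm_comb ?R (\<lambda>_. 1) v)) = trace_on ?V ?f"
    by (rule trace_sign_swap)
      (erule odd column_stabilizer_permutes row_stabilizer_permutes, assumption?)+
  then have "trace_on ?V ?f \<noteq> 0"
    using trace_young_symmetrizer_nonzero[OF lam t, where 'k = 'k] by (simp only: not_False_eq_True)
  moreover have "fun_linear ?f"
    using Vector_Spaces.linear_compose[OF linear_perm_comb linear_perm_comb] by (simp only: o_def)
  ultimately obtain v where v: "v \<in> ?V" "?f v \<noteq> 0"
    using trace_on_nonzeroD[OF fin_dim_specht_module] by blast
  have "perm_comb ?R sgn_weight v \<noteq> 0"
  proof
    interpret L: Vector_Spaces.linear fscale fscale "perm_comb ?C (\<lambda>_. 1) :: (tabloid \<Rightarrow> 'k) \<Rightarrow> _"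
      by (rule linear_perm_comb)
    assume "perm_comb ?R sgn_weight v = 0"
    then show False using v(2) L.zero by simp
  qed
  moreover have "v \<in> fun_vs.span (tabloid_vec lam ` tableaux lam)"
    using v(1) specht_module_subset unfolding tabloid_space_def by blast
  ultimately obtain s where s: "s \<in> tableaux lam"
    and "perm_comb ?R sgn_weight (tabloid_vec lam s) \<noteq> (0 :: tabloid \<Rightarrow> 'k)"
    using fun_linear_span_nonzeroD[OF linear_perm_comb] by blast
  then have inj1: "inj_on (\<lambda>x. (fst (box_of lam s x), fst (box_of lam t x))) ?X"
    using row_antisymmetrizer_nonzeroD[OF t] by blast
  have "perm_comb ?R sgn_weight v \<in> fun_vs.span (polytabloid lam ` tableaux lam)"
    using perm_comb_specht_module[OF row_stabilizer_permutes v(1)] unfolding specht_module_def .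
  then obtain u where u: "u \<in> tableaux lam"
    and "perm_comb ?C (\<lambda>_. 1) (polytabloid lam u) \<noteq> (0 :: tabloid \<Rightarrow> 'k)"
    using fun_linear_span_nonzeroD[OF linear_perm_comb _ v(2)] by blast
  then have inj2: "inj_on (\<lambda>x. (snd (box_of lam u x), snd (box_of lam t x))) ?X"
    using column_symmetrizer_nonzeroD[OF t] by blast
  have swap: "card {c \<in> prod.swap ` ?D. P c} = card {c \<in> ?D. P (prod.swap c)}" for P
  proof -
    have "{c \<in> prod.swap ` ?D. P c} = prod.swap ` {c \<in> ?D. P (prod.swap c)}" by auto
    then show ?thesis by (simp add: card_image)
  qed
  have le1: "card {c \<in> ?D. fst c < k} \<le> card {c \<in> ?D. snd c < k}" for k
  proof -
    have "card {x \<in> ?X. fst (box_of lam s x) < k} \<le> card {c \<in> prod.swap ` ?D. fst c < k}"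
    proof (rule count_below_le[OF _ inj1])
      show "card {x \<in> ?X. fst (box_of lam t x) = j} = card {c \<in> prod.swap ` ?D. snd c = j}" for j
        unfolding swap card_box_of[OF t, of "\<lambda>c. fst c = j"] by simp
      show "(i', j) \<in> prod.swap ` ?D" if "(i, j) \<in> prod.swap ` ?D" "i' \<le> i" for i i' j
        using that young_diagram_down[OF lam, of j i j i'] by auto
    qed (simp_all add: finite_young_diagram)
    then show ?thesis unfolding swap card_box_of[OF s, of "\<lambda>c. fst c < k"] by simp
  qed
  have le2: "card {c \<in> ?D. snd c < k} \<le> card {c \<in> ?D. fst c < k}" for k
  proof -
    have "card {x \<in> ?X. snd (box_of lam u x) < k} \<le> card {c \<in> ?D. fst c < k}"
    proof (rule count_below_le[OF _ inj2])
      show "card {x \<in> ?X. snd (box_of lam t x) = j} = card {c \<in> ?D. snd c = j}" for j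
        by (rule card_box_of[OF t])
      show "(i', j) \<in> ?D" if "(i, j) \<in> ?D" "i' \<le> i" for i i' j
        using young_diagram_down[OF lam that] by blast
    qed (simp_all add: finite_young_diagram)
    then show ?thesis unfolding card_box_of[OF u, of "\<lambda>c. snd c < k"] .
  qed
  have split: "card {c \<in> ?D. h c < Suc i} = card {c \<in> ?D. h c < i} + card {c \<in> ?D. h c = i}"
    for h :: "nat \<times> nat \<Rightarrow> nat"
  proof -
    have "{c \<in> ?D. h c < Suc i} = {c \<in> ?D. h c < i} \<union> {c \<in> ?D. h c = i}" by auto
    moreover have "{c \<in> ?D. h c < i} \<inter> {c \<in> ?D. h c = i} = {}" by auto
    ultimately show ?thesis using finite_young_diagram[of lam] by (simp add: card_Un_disjoint)
  qed
  show ?thesis using split[of fst] split[of snd] le1[of i] le2[of i] le1[of "Suc i"] le2[of "Suc i"] by linarith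
qed

lemma card_young_diagram_row:
  "card {c \<in> young_diagram lam. fst c = i} = (if i < length lam then lam ! i else 0)"
proof -
  have "{c \<in> young_diagram lam. fst c = i} = (if i < length lam then Pair i ` {..<lam ! i} else {})"
    by (auto simp: young_diagram_def)
  then show ?thesis by (simp add: card_image inj_on_def)
qed

lemma list_eq_if_row_lengths_eq:
  assumes a: "0 \<notin> set a" and b: "0 \<notin> set b"
    and eq: "\<And>i. card {c \<in> young_diagram a. fst c = i} = card {c \<in> young_diagram b. fst c = i}"
  shows "a = b"
proof -
  have "i < length a \<longleftrightarrow> i < length b" for i
  proof -
    have "i < length a \<Longrightarrow> a ! i \<noteq> 0" "i < length b \<Longrightarrow> b ! i \<noteq> 0"
      using a b nth_mem[of i a] nth_mem[of i b] by metis+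
    then show ?thesis using eq[of i] unfolding card_young_diagram_row by (simp split: if_splits)
  qed
  then have len: "length a = length b" by (meson linorder_neqE_nat less_irrefl)
  then show ?thesis
  proof (rule nth_equalityI)
    fix i assume "i < length a"
    then show "a ! i = b ! i" using eq[of i] len unfolding card_young_diagram_row by simp
  qed
qed

lemma self_conjugate_if_character_zero_on_odd:
  assumes part: "partition_of n lam"
    and odd: "\<And>p. p permutes {1..n} \<Longrightarrow> sign p = - 1 \<Longrightarrow> specht_character lam p = (0 :: 'k::field_char_0)"
  shows "lam = conjugate lam"
proof (rule list_eq_if_row_lengths_eq)
  have n: "sum_list lam = n" and lam: "sorted_wrt (\<ge>) lam" using part by (auto simp: partition_of_def)
  show "0 \<notin> set lam" using part by (simp add: partition_of_def)
  then show "0 \<notin> set (conjugate lam)"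
    by (cases lam) (auto simp: conjugate_def filter_empty_conv)
  fix i
  have "card {c \<in> young_diagram (conjugate lam). fst c = i} = card {c \<in> young_diagram lam. snd c = i}"
  proof -
    have "{c \<in> young_diagram (conjugate lam). fst c = i} = prod.swap ` {c \<in> young_diagram lam. snd c = i}"
      unfolding young_diagram_conjugate[OF part] by auto
    then show ?thesis by (simp add: card_image)
  qed
  moreover have "card {c \<in> young_diagram lam. fst c = i} = card {c \<in> young_diagram lam. snd c = i}"
    by (rule row_lengths_eq_column_lengths[OF lam, where 'k = 'k]) (unfold n, rule odd)
  ultimately show "card {c \<in> young_diagram lam. fst c = i} = card {c \<in> young_diagram (conjugate lam). fst c = i}"
    by (simp only:)
qed


section \<open>The three sets of permutations\<close>

lemma central_function_specht_character:
  assumes "sorted_wrt (\<ge>) lam"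
  shows "central_function (sum_list lam) (specht_character lam :: _ \<Rightarrow> 'k::field_char_0)"
  by unfold_locales (rule specht_character_conj character_sum_conjugates_eq_0[OF assms]; assumption)+

lemma self_conjugate_if_zero_on_Z_set:
  assumes part: "partition_of n lam" and l: "1 < l"
    and Z: "\<And>p. p \<in> Z_set l n \<Longrightarrow> specht_character lam p = (0 :: 'k::field_char_0)"
  shows "lam = conjugate lam"
proof -
  have n: "sum_list lam = n" and lam: "sorted_wrt (\<ge>) lam" using part by (auto simp: partition_of_def)
  interpret central_function n "specht_character lam :: _ \<Rightarrow> 'k"
    using central_function_specht_character[OF lam] unfolding n .
  show ?thesis by (rule self_conjugate_if_character_zero_on_odd[OF part odd_eq_0[OF l Z]])
qed

text \<open>
  For \<open>l\<close> beyond \<open>n\<close> the second kind of elements of \<open>Z_set l n\<close> does not occur, which reduces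
  condition (i) to condition (ii) with another \<open>l\<close>.
\<close>

lemma Z_set_subset_even_length_cycles: "n < l \<Longrightarrow> Z_set l n \<subseteq> even_length_cycles n"
proof
  fix p assume l: "n < l" and "p \<in> Z_set l n"
  then consider j where "1 \<le> j" "2 * j \<le> n" "p = cycle_of_list [1..<2 * j + 1]"
    | k where "1 \<le> k" "2 * k * l < n" unfolding Z_set_def by blast
  then show "p \<in> even_length_cycles n"
  proof cases
    case 1
    then show ?thesis unfolding even_length_cycles_def
      by (intro CollectI exI[of _ "[1..<2 * j + 1]"]) auto
  next
    case 2
    have "1 * l \<le> (2 * k) * l" using 2(1) by (intro mult_le_mono1) simp
    then show ?thesis using 2(2) l by linarith
  qed
qed

lemma cycle_of_list_funpow_length:
  assumes "cycle cs"
  shows "cycle_of_list cs ^^ length cs = id"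
proof
  fix x
  show "(cycle_of_list cs ^^ length cs) x = id x"
  proof (cases "x \<in> set cs")
    case True
    have "map (cycle_of_list cs ^^ length cs) cs = map id cs"
      using cyclic_rotation[OF assms, of "length cs"] by simp
    then show ?thesis using True unfolding map_eq_conv by blast
  next
    case False
    have "(cycle_of_list cs ^^ m) x = x" for m
      using id_outside_supp[OF False] by (induction m) simp_all
    then show ?thesis by simp
  qed
qed

lemma funpow_comp_commuting:
  assumes comm: "f \<circ> g = g \<circ> f"
  shows "(f \<circ> g) ^^ r = f ^^ r \<circ> g ^^ r"
proof (induction r)
  case (Suc r)
  have *: "g \<circ> f ^^ m = f ^^ m \<circ> g" for m
  proof (induction m)
    case (Suc m)
    have "g \<circ> f ^^ Suc m = f \<circ> (g \<circ> f ^^ m)" by (simp only: funpow.simps o_assoc comm)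
    then show ?case by (simp only: Suc funpow.simps o_assoc)
  qed simp
  have "(f \<circ> g) ^^ Suc r = f \<circ> (g \<circ> f ^^ r) \<circ> g ^^ r" by (simp only: funpow.simps Suc o_assoc)
  then show ?case by (simp only: * funpow.simps o_assoc)
qed simp

lemma sym_group_pow: "p [^]\<^bsub>sym_group n\<^esub> (m :: nat) = p ^^ m"
  by (induction m) (simp_all add: sym_group_def nat_pow_def funpow_swap1 fun_eq_iff)

lemma odd_regular_if_funpow_eq_id:
  assumes p: "p permutes {1..n}" "sign p = - 1" and m: "p ^^ m = id" "\<not> l dvd m"
  shows "p \<in> odd_regular_elements l n"
proof -
  interpret group "sym_group n" by (rule sym_group_is_group)
  have c: "p \<in> carrier (sym_group n)" using p(1) by (simp only: sym_group_carrier)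
  have "p [^]\<^bsub>sym_group n\<^esub> m = \<one>\<^bsub>sym_group n\<^esub>"
    unfolding sym_group_pow m(1) by (simp add: sym_group_def)
  then have "ord p dvd m" using pow_eq_id[OF c] by blast
  then have "\<not> l dvd ord p" using m(2) dvd_trans by blast
  moreover have "\<not> evenperm p" using p(2) by (simp add: sign_def split: if_splits)
  ultimately show ?thesis using c by (simp add: odd_regular_elements_def)
qed

text \<open>
  The two kinds of elements have orders dividing \<open>2 * j\<close> and \<open>2 * (2 * k * l - 1)\<close>; as \<open>l\<close> is odd, it
  divides the first only if it divides \<open>j\<close>, and it divides the second only if it divides \<open>1\<close>.
\<close>

lemma Z_set_subset_odd_regular_elements:
  assumes l: "1 < l" "odd l"
  shows "Z_set l n \<subseteq> odd_regular_elements l n"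
proof
  have cop: "coprime l 2" using l(2) by simp
  fix p assume "p \<in> Z_set l n"
  then consider (cycle) j where "1 \<le> j" "2 * j \<le> n" "\<not> l dvd j" "p = cycle_of_list [1..<2 * j + 1]"
    | (prod) k where "1 \<le> k" "1 < 2 * k * l" "2 * k * l < n"
        "p = cycle_of_list [1..<2 * k * l] \<circ> cycle_of_list [2 * k * l, 2 * k * l + 1]"
    unfolding Z_set_def by blast
  then show "p \<in> odd_regular_elements l n"
  proof cases
    case cycle
    let ?cs = "[1..<2 * j + 1]"
    have cs: "cycle ?cs" "length ?cs = 2 * j" "set ?cs \<subseteq> {1..n}" using cycle by auto
    show ?thesis
    proof (rule odd_regular_if_funpow_eq_id)
      show "p permutes {1..n}" unfolding cycle(4) by (rule permutes_subset[OF cycle_permutes cs(3)])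
      show "sign p = - 1" unfolding cycle(4) sign_cycle_of_list[OF cs(1)] cs(2) using cycle(1) by simp
      show "p ^^ (2 * j) = id" using cycle_of_list_funpow_length[OF cs(1)] unfolding cs(2) cycle(4) .
      show "\<not> l dvd 2 * j" using cycle(3) cop by (simp add: coprime_dvd_mult_right_iff)
    qed
  next
    case prod
    let ?m = "2 * k * l"
    let ?c = "cycle_of_list [1..<?m]" and ?d = "cycle_of_list [?m, ?m + 1]"
    have c: "cycle [1..<?m]" "set [1..<?m] \<subseteq> {1..n}" "length [1..<?m] = ?m - 1" using prod by auto
    have d: "cycle [?m, ?m + 1]" "set [?m, ?m + 1] \<subseteq> {1..n}" "length [?m, ?m + 1] = 2" using prod by auto
    show ?thesis
    proof (rule odd_regular_if_funpow_eq_id)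
      show "p permutes {1..n}" unfolding prod(4)
        by (rule permutes_compose[OF permutes_subset[OF cycle_permutes d(2)] permutes_subset[OF cycle_permutes c(2)]])
      have "sign p = sign ?c * sign ?d"
        unfolding prod(4) by (rule sign_compose[OF permutation_of_cycle permutation_of_cycle])
      also have "\<dots> = - 1"
        unfolding sign_cycle_of_list[OF c(1)] sign_cycle_of_list[OF d(1)] c(3) d(3) using prod(2)
        by simp
      finally show "sign p = - 1" .
      have comm: "?c \<circ> ?d = ?d \<circ> ?c" using c(1) d(1) by (intro cycles_commute) auto
      have pow: "p ^^ r = ?c ^^ r \<circ> ?d ^^ r" for r
        unfolding prod(4) by (rule funpow_comp_commuting[OF comm])
      have c1: "?c ^^ (?m - 1) = id" using cycle_of_list_funpow_length[OF c(1)] unfolding c(3) .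
      have d1: "?d ^^ 2 = id" using cycle_of_list_funpow_length[OF d(1)] unfolding d(3) .
      have "?c ^^ ((?m - 1) * 2) = id" by (simp only: funpow_mult[symmetric] c1 id_funpow)
      moreover have "?d ^^ ((?m - 1) * 2) = id"
        unfolding mult.commute[of "?m - 1"] by (simp only: funpow_mult[symmetric] d1 id_funpow)
      ultimately show "p ^^ ((?m - 1) * 2) = id" unfolding pow by simp
      show "\<not> l dvd (?m - 1) * 2"
      proof
        assume "l dvd (?m - 1) * 2"
        then have "l dvd ?m - 1" using cop by (simp add: coprime_dvd_mult_left_iff)
        moreover have "l dvd ?m" by simp
        ultimately have "l dvd ?m - (?m - 1)" by (rule dvd_diff_nat[rotated])
        moreover have "?m - (?m - 1) = 1" using prod(2) by simp
        ultimately show False using l(1) by simp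
      qed
    qed
  qed
qed

theorem corollary2p2:
  fixes n l :: nat and lam :: "nat list"
  assumes "1 \<le> n" and "partition_of n lam" and "1 < l" and "odd l"
  shows "((\<forall>p\<in>even_length_cycles n. (specht_character lam p :: 'k::field_char_0) = 0)
            \<longrightarrow> lam = conjugate lam) \<and>
         ((\<forall>p\<in>Z_set l n. (specht_character lam p :: 'k) = 0)
            \<longrightarrow> lam = conjugate lam) \<and>
         ((\<forall>p\<in>odd_regular_elements l n. (specht_character lam p :: 'k) = 0)
            \<longrightarrow> lam = conjugate lam)"
proof (intro conjI impI)
  assume "\<forall>p\<in>even_length_cycles n. (specht_character lam p :: 'k) = 0"
  then show "lam = conjugate lam"
    using Z_set_subset_even_length_cycles[of n "n + 1"] assms(1)
    by (intro self_conjugate_if_zero_on_Z_set[OF assms(2), of "n + 1", where 'k = 'k]) auto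
next
  assume "\<forall>p\<in>Z_set l n. (specht_character lam p :: 'k) = 0"
  then show "lam = conjugate lam"
    by (intro self_conjugate_if_zero_on_Z_set[OF assms(2,3), where 'k = 'k]) blast
next
  assume "\<forall>p\<in>odd_regular_elements l n. (specht_character lam p :: 'k) = 0"
  then show "lam = conjugate lam"
    using Z_set_subset_odd_regular_elements[OF assms(3,4), of n]
    by (intro self_conjugate_if_zero_on_Z_set[OF assms(2,3), where 'k = 'k]) blast
qed

end
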